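(* Let $a\ge0$, $b\ge|c|$ be real numbers and let $G$ be the simply-connected three-dimensional Lie group with left-invariant Riemannian metric whose metric Lie algebra has triple $(a,b,c)$. If $G$ is generic, then $S_e=\bar S_e$ and $i(G)=\bar i(G)$.
   Context: Triples. A three-dimensional metric Lie algebra $\mathfrak g$ has triple $(a,b,c)$ ($a\ge 0$, $b\ge|c|$) if it has an orthonormal basis $e_1,e_2,e_3$ with $[e_1,e_2]=ae_2+be_3$, $[e_1,e_3]=ce_2+ae_3$, $[e_2,e_3]=0$. Every three-dimensional solvable metric Lie algebra has exactly one such triple. Generic. The Ricci tensor of $G$ at $e$ is diagonalizable in an orthonormal basis of $\mathfrak g=T_eG$ with diagonal entries $R_{11}=-2a^2-\frac{(b+c)^2}{2}$, $R_{22}=-2a^2-\frac{b+c}{2}\sqrt{4a^2+(b-c)^2}$, $R_{33}=-2a^2+\frac{b+c}{2}\sqrt{4a^2+(b-c)^2}$. $G$ is called generic if $R_{11},R_{22},R_{33}$ are pairwise distinct. Index and subindex. Let $\nabla$ be the Levi-Civita connection of the left-invariant metric. A vector field $X$ on $G$ is parallel at $e$ if $(\nabla_YX)|_e=0$ for every vector field $Y$. $S_e\subseteq\mathfrak g$ is the subspace of all $X|_e$ with $X$ a Killing field parallel at $e$, and $i(G)=\dim S_e$. $\bar S_e\subseteq S_e$ is the subspace of all $R|_e$ with $R$ a right-invariant vector field parallel at $e$ (right-invariant vector fields are Killing fields for a left-invariant metric), and $\bar i(G)=\dim\bar S_e$. *)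

theory Defs
  imports
    "HOL-Analysis.Analysis"
    "HOL-Library.Function_Algebras"
    "HOL-Algebra.Group"
begin

section \<open>Smooth maps, manifolds and Lie groups\<close>

text \<open>Differentiability of class \<open>C\<^sup>k\<close>; meant for open \<open>S\<close> in a finite-dimensional space, where
  continuity of all directional derivatives is continuity of the derivative.\<close>

primrec Ck_on :: "nat \<Rightarrow> 'a::euclidean_space set \<Rightarrow> ('a \<Rightarrow> 'b::euclidean_space) \<Rightarrow> bool" where
  "Ck_on 0 S f \<longleftrightarrow> continuous_on S f"
| "Ck_on (Suc k) S f \<longleftrightarrow>
     (\<forall>x\<in>S. f differentiable (at x)) \<and> (\<forall>v. Ck_on k S (\<lambda>x. frechet_derivative f (at x) v))"

definition smooth_on :: "'a::euclidean_space set \<Rightarrow> ('a \<Rightarrow> 'b::euclidean_space) \<Rightarrow> bool" where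
  "smooth_on S f \<longleftrightarrow> (\<forall>k. Ck_on k S f)"

text \<open>A chart \<open>(U, \<phi>)\<close> is a homeomorphism from an open set of the manifold onto an open set of the
  model space; only the values of \<open>\<phi>\<close> on \<open>U\<close> matter. The underlying set of a manifold is the whole
  type \<open>'g\<close>, with its type-class topology.\<close>

type_synonym ('g, 'm) chart = "'g set \<times> ('g \<Rightarrow> 'm)"

definition is_chart :: "('g::topological_space, 'm::euclidean_space) chart \<Rightarrow> bool" where
  "is_chart c \<longleftrightarrow> (case c of (U, \<phi>) \<Rightarrow>
     open U \<and> open (\<phi> ` U) \<and> homeomorphism U (\<phi> ` U) \<phi> (inv_into U \<phi>))"

definition smooth_atlas :: "('g::topological_space, 'm::euclidean_space) chart set \<Rightarrow> bool" where
  "smooth_atlas A \<longleftrightarrow>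
     (\<forall>c\<in>A. is_chart c) \<and> (\<Union>(U, \<phi>)\<in>A. U) = UNIV \<and>
     (\<forall>(U, \<phi>)\<in>A. \<forall>(V, \<psi>)\<in>A. smooth_on (\<phi> ` (U \<inter> V)) (\<psi> \<circ> inv_into U \<phi>))"

definition product_atlas ::
    "('g, 'm) chart set \<Rightarrow> ('h, 'n) chart set \<Rightarrow> ('g \<times> 'h, 'm \<times> 'n) chart set" where
  "product_atlas A B = {(U \<times> V, map_prod \<phi> \<psi>) | U \<phi> V \<psi>. (U, \<phi>) \<in> A \<and> (V, \<psi>) \<in> B}"

definition smooth_map ::
    "('g::topological_space, 'm::euclidean_space) chart set \<Rightarrow>
     ('h::topological_space, 'n::euclidean_space) chart set \<Rightarrow> ('g \<Rightarrow> 'h) \<Rightarrow> bool" where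
  "smooth_map A B F \<longleftrightarrow>
     continuous_on UNIV F \<and>
     (\<forall>(U, \<phi>)\<in>A. \<forall>(V, \<psi>)\<in>B. smooth_on (\<phi> ` (U \<inter> F -` V)) (\<psi> \<circ> F \<circ> inv_into U \<phi>))"

definition smooth_functions ::
    "('g::topological_space, 'm::euclidean_space) chart set \<Rightarrow> ('g \<Rightarrow> real) set" where
  "smooth_functions A = {f. \<forall>(U, \<phi>)\<in>A. smooth_on (\<phi> ` U) (f \<circ> inv_into U \<phi>)}"

definition lie_group ::
    "'g::{t2_space, second_countable_topology} monoid \<Rightarrow> ('g, 'm::euclidean_space) chart set \<Rightarrow> bool"
  where
  "lie_group G A \<longleftrightarrow>
     group G \<and> carrier G = UNIV \<and> smooth_atlas A \<and>
     smooth_map (product_atlas A A) A (\<lambda>(x, y). x \<otimes>\<^bsub>G\<^esub> y) \<and>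
     smooth_map A A (\<lambda>x. inv\<^bsub>G\<^esub> x)"


section \<open>Tangent vectors and vector fields\<close>

text \<open>Tangent vectors at \<open>p\<close> are the derivations at \<open>p\<close> of the algebra of smooth functions, and
  smooth vector fields are the derivations of that algebra. Both are set to zero on non-smooth
  functions, so that they are determined by their action on smooth ones. Sums and the zero vector
  (field) are those of \<^theory>\<open>HOL-Library.Function_Algebras\<close>.\<close>

type_synonym 'g tangent = "('g \<Rightarrow> real) \<Rightarrow> real"
type_synonym 'g vfield = "('g \<Rightarrow> real) \<Rightarrow> ('g \<Rightarrow> real)"

definition tscale :: "real \<Rightarrow> 'g tangent \<Rightarrow> 'g tangent" where
  "tscale r v = (\<lambda>f. r * v f)"

definition fscale :: "('g \<Rightarrow> real) \<Rightarrow> 'g vfield \<Rightarrow> 'g vfield" where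
  "fscale h X = (\<lambda>f p. h p * X f p)"

lemma vector_space_tscale: "vector_space (tscale :: real \<Rightarrow> 'g tangent \<Rightarrow> 'g tangent)"
  by unfold_locales (auto simp: tscale_def fun_eq_iff algebra_simps)

abbreviation tangent_dim :: "'g tangent set \<Rightarrow> nat" where
  "tangent_dim \<equiv> vector_space.dim tscale"

abbreviation tangent_span :: "'g tangent set \<Rightarrow> 'g tangent set" where
  "tangent_span \<equiv> module.span tscale"

definition tangent_space ::
    "('g::topological_space, 'm::euclidean_space) chart set \<Rightarrow> 'g \<Rightarrow> 'g tangent set" where
  "tangent_space A p = {v.
     (\<forall>f. f \<notin> smooth_functions A \<longrightarrow> v f = 0) \<and>
     (\<forall>f\<in>smooth_functions A. \<forall>h\<in>smooth_functions A. \<forall>r s.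
        v (\<lambda>x. r * f x + s * h x) = r * v f + s * v h) \<and>
     (\<forall>f\<in>smooth_functions A. \<forall>h\<in>smooth_functions A.
        v (\<lambda>x. f x * h x) = v f * h p + f p * v h)}"

definition value_at :: "'g vfield \<Rightarrow> 'g \<Rightarrow> 'g tangent" where
  "value_at X p = (\<lambda>f. X f p)"

definition vector_fields ::
    "('g::topological_space, 'm::euclidean_space) chart set \<Rightarrow> 'g vfield set" where
  "vector_fields A = {X.
     (\<forall>p. value_at X p \<in> tangent_space A p) \<and>
     (\<forall>f\<in>smooth_functions A. X f \<in> smooth_functions A)}"

definition bracket :: "'g vfield \<Rightarrow> 'g vfield \<Rightarrow> 'g vfield" where
  "bracket X Y = (\<lambda>f p. X (Y f) p - Y (X f) p)"

text \<open>The differential of a smooth map \<open>F\<close> of the manifold to itself, applied to a tangent vector.\<close>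

definition pushforward ::
    "('g::topological_space, 'm::euclidean_space) chart set \<Rightarrow> ('g \<Rightarrow> 'g) \<Rightarrow> 'g tangent \<Rightarrow> 'g tangent"
  where
  "pushforward A F v = (\<lambda>f. if f \<in> smooth_functions A then v (f \<circ> F) else 0)"

definition left_invariant_fields ::
    "'g::topological_space monoid \<Rightarrow> ('g, 'm::euclidean_space) chart set \<Rightarrow> 'g vfield set" where
  "left_invariant_fields G A = {X \<in> vector_fields A. \<forall>x p.
     value_at X (x \<otimes>\<^bsub>G\<^esub> p) = pushforward A (\<lambda>q. x \<otimes>\<^bsub>G\<^esub> q) (value_at X p)}"

definition right_invariant_fields ::
    "'g::topological_space monoid \<Rightarrow> ('g, 'm::euclidean_space) chart set \<Rightarrow> 'g vfield set" where
  "right_invariant_fields G A = {X \<in> vector_fields A. \<forall>x p.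
     value_at X (p \<otimes>\<^bsub>G\<^esub> x) = pushforward A (\<lambda>q. q \<otimes>\<^bsub>G\<^esub> x) (value_at X p)}"


section \<open>Riemannian metrics, the Levi-Civita connection and Killing fields\<close>

type_synonym 'g metric_tensor = "'g \<Rightarrow> 'g tangent \<Rightarrow> 'g tangent \<Rightarrow> real"

definition metric_on_fields :: "'g metric_tensor \<Rightarrow> 'g vfield \<Rightarrow> 'g vfield \<Rightarrow> ('g \<Rightarrow> real)" where
  "metric_on_fields g X Y = (\<lambda>p. g p (value_at X p) (value_at Y p))"

definition riemannian_metric ::
    "('g::topological_space, 'm::euclidean_space) chart set \<Rightarrow> 'g metric_tensor \<Rightarrow> bool" where
  "riemannian_metric A g \<longleftrightarrow>
     (\<forall>p. \<forall>u\<in>tangent_space A p. \<forall>v\<in>tangent_space A p. \<forall>w\<in>tangent_space A p. \<forall>r s.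
        g p (tscale r u + tscale s v) w = r * g p u w + s * g p v w) \<and>
     (\<forall>p. \<forall>u\<in>tangent_space A p. \<forall>v\<in>tangent_space A p. g p u v = g p v u) \<and>
     (\<forall>p. \<forall>u\<in>tangent_space A p. u \<noteq> 0 \<longrightarrow> g p u u > 0) \<and>
     (\<forall>X\<in>vector_fields A. \<forall>Y\<in>vector_fields A. metric_on_fields g X Y \<in> smooth_functions A)"

definition left_invariant_metric ::
    "'g::topological_space monoid \<Rightarrow> ('g, 'm::euclidean_space) chart set \<Rightarrow> 'g metric_tensor \<Rightarrow> bool"
  where
  "left_invariant_metric G A g \<longleftrightarrow> riemannian_metric A g \<and>
     (\<forall>x p. \<forall>u\<in>tangent_space A p. \<forall>v\<in>tangent_space A p.
        g (x \<otimes>\<^bsub>G\<^esub> p) (pushforward A (\<lambda>q. x \<otimes>\<^bsub>G\<^esub> q) u) (pushforward A (\<lambda>q. x \<otimes>\<^bsub>G\<^esub> q) v) = g p u v)"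

text \<open>\<open>D X Y\<close> stands for \<open>\<nabla>\<^sub>X Y\<close>. The four blocks say that \<open>D\<close> is an affine connection
  (function-linear in \<open>X\<close>, additive and Leibniz in \<open>Y\<close>), torsion-free, and metric.\<close>

definition levi_civita ::
    "('g::topological_space, 'm::euclidean_space) chart set \<Rightarrow> 'g metric_tensor \<Rightarrow>
     ('g vfield \<Rightarrow> 'g vfield \<Rightarrow> 'g vfield) \<Rightarrow> bool" where
  "levi_civita A g D \<longleftrightarrow>
     (\<forall>X\<in>vector_fields A. \<forall>Y\<in>vector_fields A. D X Y \<in> vector_fields A) \<and>
     (\<forall>X\<in>vector_fields A. \<forall>Y\<in>vector_fields A. \<forall>Z\<in>vector_fields A. \<forall>h\<in>smooth_functions A.
        D (X + Y) Z = D X Z + D Y Z \<and> D (fscale h X) Z = fscale h (D X Z) \<and>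
        D X (Y + Z) = D X Y + D X Z \<and> D X (fscale h Z) = fscale (X h) Z + fscale h (D X Z)) \<and>
     (\<forall>X\<in>vector_fields A. \<forall>Y\<in>vector_fields A. D X Y - D Y X = bracket X Y) \<and>
     (\<forall>X\<in>vector_fields A. \<forall>Y\<in>vector_fields A. \<forall>Z\<in>vector_fields A.
        X (metric_on_fields g Y Z) = metric_on_fields g (D X Y) Z + metric_on_fields g Y (D X Z))"

text \<open>A vector field is Killing if the Lie derivative of the metric along it vanishes.\<close>

definition killing_fields ::
    "('g::topological_space, 'm::euclidean_space) chart set \<Rightarrow> 'g metric_tensor \<Rightarrow> 'g vfield set" where
  "killing_fields A g = {X \<in> vector_fields A.
     \<forall>Y\<in>vector_fields A. \<forall>Z\<in>vector_fields A.
       X (metric_on_fields g Y Z)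
         = metric_on_fields g (bracket X Y) Z + metric_on_fields g Y (bracket X Z)}"

definition parallel_at ::
    "('g::topological_space, 'm::euclidean_space) chart set \<Rightarrow>
     ('g vfield \<Rightarrow> 'g vfield \<Rightarrow> 'g vfield) \<Rightarrow> 'g \<Rightarrow> 'g vfield \<Rightarrow> bool" where
  "parallel_at A D p X \<longleftrightarrow> (\<forall>Y\<in>vector_fields A. value_at (D Y X) p = 0)"


section \<open>Triples, genericity, index and subindex\<close>

text \<open>The metric Lie algebra \<open>T\<^sub>eG\<close> is given through left-invariant vector fields: the bracket of
  two vectors at \<open>e\<close> is the value at \<open>e\<close> of the bracket of their left-invariant extensions.\<close>

definition has_triple ::
    "'g::topological_space monoid \<Rightarrow> ('g, 'm::euclidean_space) chart set \<Rightarrow> 'g metric_tensor \<Rightarrow>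
     real \<Rightarrow> real \<Rightarrow> real \<Rightarrow> bool" where
  "has_triple G A g a b c \<longleftrightarrow> a \<ge> 0 \<and> b \<ge> \<bar>c\<bar> \<and>
     (\<exists>E1\<in>left_invariant_fields G A. \<exists>E2\<in>left_invariant_fields G A. \<exists>E3\<in>left_invariant_fields G A.
        let e = \<one>\<^bsub>G\<^esub>; e1 = value_at E1 e; e2 = value_at E2 e; e3 = value_at E3 e in
          g e e1 e1 = 1 \<and> g e e2 e2 = 1 \<and> g e e3 e3 = 1 \<and>
          g e e1 e2 = 0 \<and> g e e1 e3 = 0 \<and> g e e2 e3 = 0 \<and>
          tangent_span {e1, e2, e3} = tangent_space A e \<and>
          value_at (bracket E1 E2) e = tscale a e2 + tscale b e3 \<and>
          value_at (bracket E1 E3) e = tscale c e2 + tscale a e3 \<and>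
          value_at (bracket E2 E3) e = 0)"

text \<open>The diagonal entries, in a suitable orthonormal basis of \<open>T\<^sub>eG\<close>, of the Ricci tensor at \<open>e\<close>
  of a Lie group with triple \<open>(a, b, c)\<close>.\<close>

definition ricci11 :: "real \<Rightarrow> real \<Rightarrow> real \<Rightarrow> real" where
  "ricci11 a b c = - 2 * a\<^sup>2 - (b + c)\<^sup>2 / 2"

definition ricci22 :: "real \<Rightarrow> real \<Rightarrow> real \<Rightarrow> real" where
  "ricci22 a b c = - 2 * a\<^sup>2 - (b + c) / 2 * sqrt (4 * a\<^sup>2 + (b - c)\<^sup>2)"

definition ricci33 :: "real \<Rightarrow> real \<Rightarrow> real \<Rightarrow> real" where
  "ricci33 a b c = - 2 * a\<^sup>2 + (b + c) / 2 * sqrt (4 * a\<^sup>2 + (b - c)\<^sup>2)"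

definition generic :: "real \<Rightarrow> real \<Rightarrow> real \<Rightarrow> bool" where
  "generic a b c \<longleftrightarrow>
     ricci11 a b c \<noteq> ricci22 a b c \<and> ricci11 a b c \<noteq> ricci33 a b c \<and>
     ricci22 a b c \<noteq> ricci33 a b c"

definition index_space ::
    "'g::topological_space monoid \<Rightarrow> ('g, 'm::euclidean_space) chart set \<Rightarrow> 'g metric_tensor \<Rightarrow>
     ('g vfield \<Rightarrow> 'g vfield \<Rightarrow> 'g vfield) \<Rightarrow> 'g tangent set" where
  "index_space G A g D =
     {value_at X \<one>\<^bsub>G\<^esub> | X. X \<in> killing_fields A g \<and> parallel_at A D \<one>\<^bsub>G\<^esub> X}"

definition subindex_space ::
    "'g::topological_space monoid \<Rightarrow> ('g, 'm::euclidean_space) chart set \<Rightarrow>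
     ('g vfield \<Rightarrow> 'g vfield \<Rightarrow> 'g vfield) \<Rightarrow> 'g tangent set" where
  "subindex_space G A D =
     {value_at R \<one>\<^bsub>G\<^esub> | R. R \<in> right_invariant_fields G A \<and> parallel_at A D \<one>\<^bsub>G\<^esub> R}"

definition index ::
    "'g::topological_space monoid \<Rightarrow> ('g, 'm::euclidean_space) chart set \<Rightarrow> 'g metric_tensor \<Rightarrow>
     ('g vfield \<Rightarrow> 'g vfield \<Rightarrow> 'g vfield) \<Rightarrow> nat" where
  "index G A g D = tangent_dim (index_space G A g D)"

definition subindex ::
    "'g::topological_space monoid \<Rightarrow> ('g, 'm::euclidean_space) chart set \<Rightarrow>
     ('g vfield \<Rightarrow> 'g vfield \<Rightarrow> 'g vfield) \<Rightarrow> nat" where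
  "subindex G A D = tangent_dim (subindex_space G A D)"

end

theory Submission
  imports Defs "HOL-Real_Asymp.Real_Asymp"
begin

text \<open>Let \<open>E\<^sub>1, E\<^sub>2, E\<^sub>3\<close> be the left-invariant orthonormal frame of the triple and \<open>X\<close> a Killing
  field. Then \<open>[X, E\<^sub>1] = u E\<^sub>2 + v E\<^sub>3\<close>, \<open>[X, E\<^sub>2] = - u E\<^sub>1 + w E\<^sub>3\<close>, \<open>[X, E\<^sub>3] = - v E\<^sub>1 - w E\<^sub>2\<close> for smooth
  functions \<open>u, v, w\<close>. The Jacobi identity for \<open>X, E\<^sub>i, E\<^sub>j\<close> expresses all derivatives \<open>E\<^sub>k u, E\<^sub>k v, E\<^sub>k w\<close>
  linearly in \<open>u, v, w\<close>, and comparing \<open>E\<^sub>i E\<^sub>j - E\<^sub>j E\<^sub>i\<close> with the bracket relations gives linear equations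
  for \<open>u, v, w\<close>, which have only the zero solution when the triple is generic. So every Killing field
  commutes with all left-invariant fields, as right-invariant fields do. For such a field \<open>X\<close> and a
  left-invariant \<open>Y\<close> we have \<open>\<nabla>\<^sub>Y X = \<nabla>\<^sub>X Y\<close>, so being parallel at \<open>e\<close> depends on \<open>X\<close> only through \<open>X|\<^sub>e\<close>, and
  \<open>X\<close> may be replaced by the right-invariant field with the same value at \<open>e\<close>.\<close>


section \<open>Differentiable functions of class \<open>C\<^sup>k\<close> and a bump function\<close>

text \<open>The algebra with \<open>u, v, w\<close> is short; the analytic weight lies in showing
  that right-invariant and left-invariant fields commute. Tangent vectors are bare derivations of
  the algebra of globally smooth functions, so interchanging a left with a right derivative of
  \<open>f (p \<otimes> q)\<close> requires writing them as directional derivatives in a chart, to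
  which the symmetry of second derivatives applies. For that, the coordinate derivations must be
  separated by global functions; hence the bump function and the role of the Hausdorff property.
  Since the frame is global, fields are handled through their components, and right-invariant fields
  are obtained from left-invariant ones by inversion, so flows and the exponential map never enter.
  Genericity acts as two nondegeneracy conditions: one Ricci inequality forces \<open>w = 0\<close>,
  the other two make the determinant of the system for \<open>u, v\<close> nonzero.\<close>

lemma has_derivative_frechet:
  "f differentiable (at x) \<Longrightarrow> (f has_derivative frechet_derivative f (at x)) (at x)"
  using frechet_derivative_works by blast

lemma frechet_derivativeI:
  "(f has_derivative f') (at x) \<Longrightarrow> frechet_derivative f (at x) = f'"
  using frechet_derivative_at by metis

text \<open>The derivative at a point of the open set \<open>S\<close> sees only values in
  \<open>S\<close>, so equality on \<open>S\<close> passes to all derivatives. This permits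
  rewriting inside a chart, where formulas agree only on the chart image.\<close>

lemma Ck_on_cong:
  assumes "open S" "\<And>x. x \<in> S \<Longrightarrow> f x = g x"
  shows "Ck_on k S f \<longleftrightarrow> Ck_on k S g"
proof -
  have *: "Ck_on k S g" if "Ck_on k S f" "\<And>x. x \<in> S \<Longrightarrow> f x = g x" for f g :: "'a \<Rightarrow> 'b"
    using that
  proof (induction k arbitrary: f g)
    case 0
    then show ?case using continuous_on_cong by fastforce
  next
    case (Suc k)
    have d: "(g has_derivative frechet_derivative f (at x)) (at x)" if "x \<in> S" for x
      using has_derivative_transform_within_open[OF has_derivative_frechet assms(1) that]
        Suc.prems that by auto
    have "Ck_on k S (\<lambda>x. frechet_derivative g (at x) v)" for v
      by (rule Suc.IH[of "\<lambda>x. frechet_derivative f (at x) v"])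
         (use Suc.prems frechet_derivativeI[OF d] in auto)
    then show ?case using d by (auto simp: differentiable_def)
  qed
  show ?thesis using *[of f g] *[of g f] assms by auto
qed

text \<open>Serves to check smoothness near each point in a chart picked for that point.\<close>

lemma Ck_on_local:
  assumes "\<And>x. x \<in> S \<Longrightarrow> \<exists>T. open T \<and> x \<in> T \<and> Ck_on k T f"
  shows "Ck_on k S f"
  using assms
proof (induction k arbitrary: f)
  case 0
  have "continuous (at x within S) f" if "x \<in> S" for x
    using 0[OF that] by (auto simp: continuous_on_eq_continuous_at continuous_at_imp_continuous_at_within)
  then show ?case by (auto simp: continuous_on_eq_continuous_within)
next
  case (Suc k)
  then show ?case by (fastforce intro!: Suc.IH)
qed

lemma Ck_on_imp_continuous_on: "open S \<Longrightarrow> Ck_on k S f \<Longrightarrow> continuous_on S f"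
  by (cases k) (auto intro!: continuous_at_imp_continuous_on differentiable_imp_continuous_within)

text \<open>The recursion does not say that class \<open>Suc k\<close> is contained in class
  \<open>k\<close>; the product rule needs this for the factor left undifferentiated, the chain rule
  for the inner function.\<close>

lemma Ck_on_Suc_imp: "open S \<Longrightarrow> Ck_on (Suc k) S f \<Longrightarrow> Ck_on k S f"
proof (induction k arbitrary: f)
  case 0
  then show ?case using Ck_on_imp_continuous_on by fastforce
next
  case (Suc k)
  then show ?case by (metis Ck_on.simps(2))
qed

lemma Ck_on_const: "Ck_on k S (\<lambda>x. c)"
  by (induction k arbitrary: c) auto

lemma Ck_on_linear: "bounded_linear L \<Longrightarrow> Ck_on k S L"
proof (induction k)
  case 0
  then show ?case by (simp add: linear_continuous_on)
next
  case (Suc k)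
  then show ?case
    by (auto simp: Ck_on_const frechet_derivativeI[OF bounded_linear_imp_has_derivative]
        intro: bounded_linear_imp_differentiable)
qed

text \<open>Any formula \<open>f'\<close> for the derivative is allowed, so closure properties can
  be proved on the right-hand sides of the product and chain rules.\<close>

lemma Ck_on_Suc_I:
  assumes "open S" "\<And>x. x \<in> S \<Longrightarrow> (f has_derivative f' x) (at x)" "\<And>v. Ck_on k S (\<lambda>x. f' x v)"
  shows "Ck_on (Suc k) S f"
proof -
  have "Ck_on k S (\<lambda>x. frechet_derivative f (at x) v)" for v
    using Ck_on_cong[OF assms(1), of "\<lambda>x. frechet_derivative f (at x) v" "\<lambda>x. f' x v"]
      frechet_derivativeI[OF assms(2)] assms(3) by auto
  then show ?thesis using assms(2) by (auto simp: differentiable_def)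
qed

lemma Ck_on_linear_compose:
  assumes "open S" "bounded_linear L" "Ck_on k S f"
  shows "Ck_on k S (\<lambda>x. L (f x))"
  using assms(3)
proof (induction k arbitrary: f)
  case 0
  then show ?case
    unfolding Ck_on.simps by (rule bounded_linear.continuous_on[OF assms(2)])
next
  case (Suc k)
  show ?case
    by (rule Ck_on_Suc_I[OF assms(1), where f' = "\<lambda>x v. L (frechet_derivative f (at x) v)"])
       (use Suc in \<open>auto intro!: bounded_linear.has_derivative[OF assms(2)] has_derivative_frechet\<close>)
qed

lemma Ck_on_add:
  assumes "open S" "Ck_on k S f" "Ck_on k S g"
  shows "Ck_on k S (\<lambda>x. f x + g x)"
  using assms(2,3)
proof (induction k arbitrary: f g)
  case 0
  then show ?case by (simp add: continuous_on_add)
next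
  case (Suc k)
  show ?case
    by (rule Ck_on_Suc_I[OF assms(1),
          where f' = "\<lambda>x v. frechet_derivative f (at x) v + frechet_derivative g (at x) v"])
       (use Suc in \<open>auto intro!: has_derivative_add has_derivative_frechet\<close>)
qed

lemma Ck_on_sum:
  assumes "open S" "\<And>i. i \<in> I \<Longrightarrow> Ck_on k S (f i)"
  shows "Ck_on k S (\<lambda>x. \<Sum>i\<in>I. f i x)"
  using assms(2)
  by (induction I rule: infinite_finite_induct) (auto intro: Ck_on_const Ck_on_add[OF assms(1)])

lemma Ck_on_scaleR:
  fixes f :: "'a::euclidean_space \<Rightarrow> real" and g :: "'a \<Rightarrow> 'b::euclidean_space"
  assumes "open S" "Ck_on k S f" "Ck_on k S g"
  shows "Ck_on k S (\<lambda>x. f x *\<^sub>R g x)"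
  using assms(2,3)
proof (induction k arbitrary: f g)
  case 0
  then show ?case by (simp add: continuous_on_scaleR)
next
  case (Suc k)
  show ?case
  proof (rule Ck_on_Suc_I[OF assms(1), where f' = "\<lambda>x v. f x *\<^sub>R frechet_derivative g (at x) v +
            frechet_derivative f (at x) v *\<^sub>R g x"])
    show "((\<lambda>x. f x *\<^sub>R g x) has_derivative
        (\<lambda>v. f x *\<^sub>R frechet_derivative g (at x) v + frechet_derivative f (at x) v *\<^sub>R g x)) (at x)"
      if "x \<in> S" for x
      using Suc.prems that by (auto intro!: has_derivative_scaleR has_derivative_frechet)
    show "Ck_on k S (\<lambda>x. f x *\<^sub>R frechet_derivative g (at x) v + frechet_derivative f (at x) v *\<^sub>R g x)" for v
      by (rule Ck_on_add[OF assms(1)]; rule Suc.IH)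
         (use Suc.prems Ck_on_Suc_imp[OF assms(1)] in \<open>auto simp del: Ck_on.simps simp: Ck_on.simps(2)\<close>)
  qed
qed

lemma Ck_on_mult:
  fixes f g :: "'a::euclidean_space \<Rightarrow> real"
  shows "open S \<Longrightarrow> Ck_on k S f \<Longrightarrow> Ck_on k S g \<Longrightarrow> Ck_on k S (\<lambda>x. f x * g x)"
  using Ck_on_scaleR[of S k f g] by simp

text \<open>The derivative of \<open>g\<close> at \<open>f x\<close> is taken in a direction that
  moves with \<open>x\<close>, whereas \<open>Ck_on\<close> controls derivatives in fixed
  directions. Expanding the direction in \<open>Basis\<close> leaves products of a component of the
  derivative of \<open>f\<close> with a fixed directional derivative of \<open>g\<close> composed
  with \<open>f\<close>, to which the induction hypothesis applies.\<close>

lemma Ck_on_compose: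
  assumes "open S" "open T" "f ` S \<subseteq> T" "Ck_on k T g" "Ck_on k S f"
  shows "Ck_on k S (\<lambda>x. g (f x))"
  using assms(4,5)
proof (induction k arbitrary: g)
  case 0
  then show ?case using assms(3) by (auto intro: continuous_on_compose2)
next
  case (Suc k)
  have f: "Ck_on k S f"
    using Ck_on_Suc_imp[OF assms(1) Suc.prems(2)] .
  show ?case
  proof (rule Ck_on_Suc_I[OF assms(1), where f' = "\<lambda>x v. \<Sum>i\<in>Basis.
           (frechet_derivative f (at x) v \<bullet> i) *\<^sub>R frechet_derivative g (at (f x)) i"])
    show "Ck_on k S (\<lambda>x. \<Sum>i\<in>Basis. (frechet_derivative f (at x) v \<bullet> i) *\<^sub>R
             frechet_derivative g (at (f x)) i)" for v
    proof (intro Ck_on_sum Ck_on_scaleR assms(1))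
      fix i
      show "Ck_on k S (\<lambda>x. frechet_derivative f (at x) v \<bullet> i)"
      proof -
        have "Ck_on k S (\<lambda>x. frechet_derivative f (at x) v)" using Suc.prems(2) by simp
        from Ck_on_linear_compose[OF assms(1) bounded_linear_inner_left this] show ?thesis .
      qed
      show "Ck_on k S (\<lambda>x. frechet_derivative g (at (f x)) i)"
        using Suc.IH[OF _ f, of "\<lambda>y. frechet_derivative g (at y) i"] Suc.prems(1) by simp
    qed
    fix x assume "x \<in> S"
    then have df: "(f has_derivative frechet_derivative f (at x)) (at x)"
      and dg: "(g has_derivative frechet_derivative g (at (f x))) (at (f x))"
      using Suc.prems assms(3) by (auto intro!: has_derivative_frechet)
    have lin: "linear (frechet_derivative g (at (f x)))"
      using dg has_derivative_linear by blast
    have expand: "frechet_derivative g (at (f x)) w =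
        (\<Sum>i\<in>Basis. (w \<bullet> i) *\<^sub>R frechet_derivative g (at (f x)) i)" for w
    proof -
      have "frechet_derivative g (at (f x)) (\<Sum>i\<in>Basis. (w \<bullet> i) *\<^sub>R i) =
          (\<Sum>i\<in>Basis. (w \<bullet> i) *\<^sub>R frechet_derivative g (at (f x)) i)"
        by (simp only: linear_sum[OF lin] linear_cmul[OF lin])
      then show ?thesis by (simp only: euclidean_representation)
    qed
    show "((\<lambda>x. g (f x)) has_derivative (\<lambda>v. \<Sum>i\<in>Basis.
           (frechet_derivative f (at x) v \<bullet> i) *\<^sub>R frechet_derivative g (at (f x)) i)) (at x)"
      by (rule has_derivative_eq_rhs[OF has_derivative_compose[OF df dg]], rule ext, rule expand)
  qed
qed

lemma smooth_on_cong:
  assumes "open S" "\<And>x. x \<in> S \<Longrightarrow> f x = g x" "smooth_on S f"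
  shows "smooth_on S g"
  using assms Ck_on_cong unfolding smooth_on_def by blast

lemma smooth_on_local:
  assumes "\<And>x. x \<in> S \<Longrightarrow> \<exists>T. open T \<and> x \<in> T \<and> smooth_on T f"
  shows "smooth_on S f"
  unfolding smooth_on_def
proof
  show "Ck_on k S f" for k
    by (rule Ck_on_local) (use assms in \<open>auto simp: smooth_on_def\<close>)
qed

lemma smooth_on_compose:
  assumes "open S" "open T" "f ` S \<subseteq> T" "smooth_on T g" "smooth_on S f"
  shows "smooth_on S (\<lambda>x. g (f x))"
  using assms Ck_on_compose unfolding smooth_on_def by blast

lemma smooth_on_const: "smooth_on S (\<lambda>x. c)"
  by (simp add: smooth_on_def Ck_on_const)

lemma smooth_on_linear: "bounded_linear L \<Longrightarrow> smooth_on S L"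
  by (simp add: smooth_on_def Ck_on_linear)

lemma smooth_on_add: "open S \<Longrightarrow> smooth_on S f \<Longrightarrow> smooth_on S g \<Longrightarrow> smooth_on S (\<lambda>x. f x + g x)"
  by (simp add: smooth_on_def Ck_on_add)

lemma smooth_on_sum:
  "open S \<Longrightarrow> (\<And>i. i \<in> I \<Longrightarrow> smooth_on S (f i)) \<Longrightarrow> smooth_on S (\<lambda>x. \<Sum>i\<in>I. f i x)"
  by (simp add: smooth_on_def Ck_on_sum)

lemma smooth_on_mult:
  fixes f g :: "'a::euclidean_space \<Rightarrow> real"
  shows "open S \<Longrightarrow> smooth_on S f \<Longrightarrow> smooth_on S g \<Longrightarrow> smooth_on S (\<lambda>x. f x * g x)"
  by (simp add: smooth_on_def Ck_on_mult)

lemma smooth_on_imp_differentiable: "smooth_on S f \<Longrightarrow> x \<in> S \<Longrightarrow> f differentiable (at x)"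
  unfolding smooth_on_def by (metis Ck_on.simps(2))

lemma smooth_on_frechet_derivative:
  "smooth_on S f \<Longrightarrow> smooth_on S (\<lambda>x. frechet_derivative f (at x) v)"
  unfolding smooth_on_def by (metis Ck_on.simps(2))

lemma smooth_on_imp_continuous_on: "smooth_on S f \<Longrightarrow> continuous_on S f"
  unfolding smooth_on_def using Ck_on.simps(1) by blast

section \<open>Symmetry of second derivatives\<close>

lemma second_difference_mean_value:
  fixes f :: "'a::euclidean_space \<Rightarrow> real"
  assumes h: "0 < h" and S: "\<And>s t. s \<in> {0..h} \<Longrightarrow> t \<in> {0..h} \<Longrightarrow> x + s *\<^sub>R u + t *\<^sub>R v \<in> S"
    and f: "\<And>y. y \<in> S \<Longrightarrow> f differentiable (at y)"
    and df: "\<And>y. y \<in> S \<Longrightarrow> (\<lambda>z. frechet_derivative f (at z) u) differentiable (at y)"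
  shows "\<exists>s\<in>{0..h}. \<exists>t\<in>{0..h}.
    f (x + h *\<^sub>R u + h *\<^sub>R v) - f (x + h *\<^sub>R u) - f (x + h *\<^sub>R v) + f x =
    h\<^sup>2 * frechet_derivative (\<lambda>z. frechet_derivative f (at z) u) (at (x + s *\<^sub>R u + t *\<^sub>R v)) v"
proof -
  have along: "((\<lambda>r. F (p + r *\<^sub>R w)) has_real_derivative frechet_derivative F (at (p + r *\<^sub>R w)) w) (at r)"
    if "F differentiable (at (p + r *\<^sub>R w))" for F :: "'a \<Rightarrow> real" and p w r
  proof -
    have "((\<lambda>r. F (p + r *\<^sub>R w)) has_derivative (\<lambda>r'. frechet_derivative F (at (p + r *\<^sub>R w)) (r' *\<^sub>R w))) (at r)"
      by (rule has_derivative_compose[where f = "\<lambda>r. p + r *\<^sub>R w", OF _ has_derivative_frechet[OF that]])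
         (auto intro!: derivative_eq_intros)
    moreover have "linear (frechet_derivative F (at (p + r *\<^sub>R w)))"
      using linear_frechet_derivative[OF that] .
    ultimately show ?thesis
      by (simp add: has_field_derivative_def linear_cmul mult_commute_abs)
  qed
  \<comment> \<open>The second difference is the increment of \<open>?\<phi>\<close> over
    \<open>[0, h]\<close>. The mean value theorem turns it into a difference of derivatives along
    \<open>u\<close>, which is in turn an increment of \<open>?\<psi>\<close> along
    \<open>v\<close>.\<close>
  let ?\<phi> = "\<lambda>s. f ((x + h *\<^sub>R v) + s *\<^sub>R u) - f (x + s *\<^sub>R u)"
  have "\<exists>s>0. s < h \<and> ?\<phi> h - ?\<phi> 0 = (h - 0) *
     (frechet_derivative f (at ((x + h *\<^sub>R v) + s *\<^sub>R u)) u - frechet_derivative f (at (x + s *\<^sub>R u)) u)"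
  proof (rule MVT2[OF h])
    fix s assume s: "0 \<le> s" "s \<le> h"
    show "(?\<phi> has_real_derivative (frechet_derivative f (at ((x + h *\<^sub>R v) + s *\<^sub>R u)) u
       - frechet_derivative f (at (x + s *\<^sub>R u)) u)) (at s)"
      by (intro DERIV_diff along f)
         (use S[of s h] S[of s 0] s h in \<open>auto simp: algebra_simps\<close>)
  qed
  then obtain s where s: "0 < s" "s < h" "?\<phi> h - ?\<phi> 0 = h *
     (frechet_derivative f (at ((x + h *\<^sub>R v) + s *\<^sub>R u)) u - frechet_derivative f (at (x + s *\<^sub>R u)) u)"
    by auto
  let ?\<psi> = "\<lambda>t. frechet_derivative f (at ((x + s *\<^sub>R u) + t *\<^sub>R v)) u"
  have "\<exists>t>0. t < h \<and> ?\<psi> h - ?\<psi> 0 = (h - 0) *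
     frechet_derivative (\<lambda>z. frechet_derivative f (at z) u) (at ((x + s *\<^sub>R u) + t *\<^sub>R v)) v"
  proof (rule MVT2[OF h])
    fix t assume t: "0 \<le> t" "t \<le> h"
    show "(?\<psi> has_real_derivative frechet_derivative (\<lambda>z. frechet_derivative f (at z) u)
        (at ((x + s *\<^sub>R u) + t *\<^sub>R v)) v) (at t)"
      by (rule along, rule df) (use S[of s t] s t in auto)
  qed
  then obtain t where t: "0 < t" "t < h" "?\<psi> h - ?\<psi> 0 = h *
     frechet_derivative (\<lambda>z. frechet_derivative f (at z) u) (at ((x + s *\<^sub>R u) + t *\<^sub>R v)) v"
    by auto
  have eq: "(x + h *\<^sub>R v) + s *\<^sub>R u = (x + s *\<^sub>R u) + h *\<^sub>R v" by (simp add: algebra_simps)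
  have "f (x + h *\<^sub>R u + h *\<^sub>R v) - f (x + h *\<^sub>R u) - f (x + h *\<^sub>R v) + f x = ?\<phi> h - ?\<phi> 0"
    by (simp add: algebra_simps)
  also have "\<dots> = h * (?\<psi> h - ?\<psi> 0)" using s(3) by (simp add: eq)
  finally have "f (x + h *\<^sub>R u + h *\<^sub>R v) - f (x + h *\<^sub>R u) - f (x + h *\<^sub>R v) + f x =
    h\<^sup>2 * frechet_derivative (\<lambda>z. frechet_derivative f (at z) u) (at (x + s *\<^sub>R u + t *\<^sub>R v)) v"
    using t(3) by (simp add: power2_eq_square)
  then show ?thesis using s t by force
qed

text \<open>The second difference over a parallelogram is symmetric in \<open>u\<close> and
  \<open>v\<close>, so both iterated derivatives take the same value, each at its own point of a
  small parallelogram at \<open>x\<close>; continuity moves the two points to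
  \<open>x\<close>.\<close>

lemma second_derivative_symmetric:
  fixes f :: "'a::euclidean_space \<Rightarrow> real"
  assumes "open S" "x \<in> S" "smooth_on S f"
  shows "frechet_derivative (\<lambda>z. frechet_derivative f (at z) u) (at x) v =
         frechet_derivative (\<lambda>z. frechet_derivative f (at z) v) (at x) u"
proof -
  let ?P = "\<lambda>u v y. frechet_derivative (\<lambda>z. frechet_derivative f (at z) u) (at y) v"
  have cont: "continuous (at x) (?P u v)" for u v
    using smooth_on_imp_continuous_on[OF smooth_on_frechet_derivative[OF
          smooth_on_frechet_derivative[OF assms(3)]]] assms(1,2) continuous_on_eq_continuous_at by blast
  have near: "\<bar>?P u v x - ?P v u x\<bar> < 2 * e" if e: "e > 0" for e
  proof -
    obtain d1 where d1: "d1 > 0" "\<And>y. dist y x < d1 \<Longrightarrow> dist (?P u v y) (?P u v x) < e"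
      using cont[of u v] e unfolding continuous_at_eps_delta by blast
    obtain d2 where d2: "d2 > 0" "\<And>y. dist y x < d2 \<Longrightarrow> dist (?P v u y) (?P v u x) < e"
      using cont[of v u] e unfolding continuous_at_eps_delta by blast
    obtain d3 where d3: "d3 > 0" "\<And>y. dist y x < d3 \<Longrightarrow> y \<in> S"
      using assms(1,2) unfolding open_dist by blast
    define d where "d = min d1 (min d2 d3)"
    have d: "d > 0" using d1 d2 d3 by (simp add: d_def)
    \<comment> \<open>The summand 1 keeps the denominator positive when \<open>u = v = 0\<close> and
      keeps the parallelogram strictly inside the ball of radius \<open>d\<close>.\<close>
    define h where "h = d / (norm u + norm v + 1)"
    have N: "norm u + norm v + 1 > 0" by (simp add: add_nonneg_pos)
    have h: "h > 0" using d N by (simp add: h_def)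
    have close: "dist (x + s *\<^sub>R u + t *\<^sub>R v) x < d" if "s \<in> {0..h}" "t \<in> {0..h}" for s t
    proof -
      have "dist (x + s *\<^sub>R u + t *\<^sub>R v) x = norm (s *\<^sub>R u + t *\<^sub>R v)" by (simp add: dist_norm)
      also have "\<dots> \<le> s * norm u + t * norm v"
        using norm_triangle_ineq[of "s *\<^sub>R u" "t *\<^sub>R v"] that by simp
      also have "\<dots> \<le> h * norm u + h * norm v"
        using that by (intro add_mono mult_right_mono) auto
      also have "\<dots> < h * (norm u + norm v + 1)" using h by (simp add: algebra_simps)
      also have "\<dots> = d" using N by (simp add: h_def)
      finally show ?thesis .
    qed
    have inS: "x + s *\<^sub>R u + t *\<^sub>R v \<in> S" if "s \<in> {0..h}" "t \<in> {0..h}" for s t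
      using d3(2) close[OF that] by (auto simp: d_def)
    have inS': "x + s *\<^sub>R v + t *\<^sub>R u \<in> S" if "s \<in> {0..h}" "t \<in> {0..h}" for s t
      using inS[OF that(2,1)] by (simp add: add_ac)
    note diff = smooth_on_imp_differentiable[OF assms(3)]
      smooth_on_imp_differentiable[OF smooth_on_frechet_derivative[OF assms(3)]]
    obtain s t where st: "s \<in> {0..h}" "t \<in> {0..h}"
      "f (x + h *\<^sub>R u + h *\<^sub>R v) - f (x + h *\<^sub>R u) - f (x + h *\<^sub>R v) + f x =
        h\<^sup>2 * ?P u v (x + s *\<^sub>R u + t *\<^sub>R v)"
      using second_difference_mean_value[OF h inS diff] by blast
    obtain s' t' where st': "s' \<in> {0..h}" "t' \<in> {0..h}"
      "f (x + h *\<^sub>R v + h *\<^sub>R u) - f (x + h *\<^sub>R v) - f (x + h *\<^sub>R u) + f x =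
        h\<^sup>2 * ?P v u (x + s' *\<^sub>R v + t' *\<^sub>R u)"
      using second_difference_mean_value[OF h inS' diff] by blast
    have "h\<^sup>2 * ?P u v (x + s *\<^sub>R u + t *\<^sub>R v) = h\<^sup>2 * ?P v u (x + s' *\<^sub>R v + t' *\<^sub>R u)"
      using st(3) st'(3) by (simp add: algebra_simps)
    then have "?P u v (x + s *\<^sub>R u + t *\<^sub>R v) = ?P v u (x + t' *\<^sub>R u + s' *\<^sub>R v)"
      using h by (simp add: add_ac)
    moreover have "\<bar>?P u v (x + s *\<^sub>R u + t *\<^sub>R v) - ?P u v x\<bar> < e"
      using d1(2) close[OF st(1,2)] by (auto simp: d_def dist_real_def)
    moreover have "\<bar>?P v u (x + t' *\<^sub>R u + s' *\<^sub>R v) - ?P v u x\<bar> < e"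
      using d2(2) close[OF st'(2,1)] by (auto simp: d_def dist_real_def)
    ultimately show ?thesis by linarith
  qed
  show ?thesis
  proof (rule ccontr)
    assume "?P u v x \<noteq> ?P v u x"
    then show False using near[of "\<bar>?P u v x - ?P v u x\<bar> / 2"] by simp
  qed
qed

section \<open>A smooth bump function\<close>

definition flat_exp :: "nat \<Rightarrow> real \<Rightarrow> real" where
  "flat_exp n t = (if t > 0 then inverse t ^ n * exp (- inverse t) else 0)"

lemma flat_exp_tendsto_0: "(flat_exp n \<longlongrightarrow> 0) (at 0)"
proof -
  have "((\<lambda>t::real. inverse t ^ n * exp (- inverse t)) \<longlongrightarrow> 0) (at_right 0)" by real_asymp
  then have "(flat_exp n \<longlongrightarrow> 0) (at_right 0)"
    by (rule Lim_transform_eventually)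
       (auto simp: eventually_at_right_field flat_exp_def intro: exI[of _ 1])
  moreover have "(flat_exp n \<longlongrightarrow> 0) (at_left 0)"
    by (rule Lim_transform_eventually[OF tendsto_const])
       (auto simp: eventually_at_left_field flat_exp_def intro: exI[of _ "-1"])
  ultimately show ?thesis by (simp add: filterlim_split_at)
qed

text \<open>The family is closed under differentiation up to linear combinations, which is what the
  parameter \<open>n\<close> is for: smoothness of the classical flat function
  \<open>flat_exp 0\<close> follows by one induction over all \<open>n\<close>.\<close>

lemma DERIV_flat_exp:
  "(flat_exp n has_real_derivative flat_exp (n + 2) t - real n * flat_exp (n + 1) t) (at t)"
proof (cases t "0::real" rule: linorder_cases)
  case less
  then have "((\<lambda>_. 0) has_real_derivative flat_exp (n + 2) t - real n * flat_exp (n + 1) t) (at t)"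
    by (simp add: flat_exp_def)
  then show ?thesis
    by (rule has_field_derivative_transform_within_open[where S = "{..<0}"])
       (use less in \<open>auto simp: flat_exp_def\<close>)
next
  case equal
  \<comment> \<open>At 0 the difference quotient of \<open>flat_exp n\<close> is
    \<open>flat_exp (Suc n)\<close>, so the limit is known from the next exponent.\<close>
  have "((\<lambda>h. (flat_exp n (0 + h) - flat_exp n 0) / h) \<longlongrightarrow> 0) (at 0)"
    by (rule Lim_transform_eventually[OF flat_exp_tendsto_0[of "Suc n"]])
       (auto simp: eventually_at flat_exp_def divide_inverse intro: exI[of _ 1])
  then show ?thesis by (simp add: equal DERIV_def flat_exp_def)
next
  case greater
  have "((\<lambda>t. inverse t ^ n * exp (- inverse t)) has_real_derivative
      real n * inverse t ^ (n - 1) * - (inverse t * inverse t) * exp (- inverse t) +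
      inverse t ^ n * (exp (- inverse t) * (inverse t * inverse t))) (at t)"
    using greater by (auto intro!: derivative_eq_intros)
  moreover have "real n * inverse t ^ (n - 1) * - (inverse t * inverse t) * exp (- inverse t) +
      inverse t ^ n * (exp (- inverse t) * (inverse t * inverse t)) =
      flat_exp (n + 2) t - real n * flat_exp (n + 1) t"
    using greater by (cases n) (simp_all add: flat_exp_def algebra_simps)
  ultimately have "((\<lambda>t. inverse t ^ n * exp (- inverse t)) has_real_derivative
      flat_exp (n + 2) t - real n * flat_exp (n + 1) t) (at t)" by simp
  then show ?thesis
    by (rule has_field_derivative_transform_within_open[where S = "{0<..}"])
       (use greater in \<open>auto simp: flat_exp_def\<close>)
qed

lemma smooth_on_flat_exp: "smooth_on UNIV (flat_exp n)"
proof -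
  have "Ck_on k UNIV (flat_exp n)" for k
  proof (induction k arbitrary: n)
    case 0
    show ?case
      using DERIV_isCont[OF DERIV_flat_exp] by (simp add: continuous_on_eq_continuous_at)
  next
    case (Suc k)
    show ?case
    proof (rule Ck_on_Suc_I)
      show "(flat_exp n has_derivative
          (\<lambda>v. (flat_exp (n + 2) t + (- real n) * flat_exp (n + 1) t) * v)) (at t)" for t
        using DERIV_flat_exp[of n t] by (simp add: has_field_derivative_def)
      show "Ck_on k UNIV (\<lambda>t. (flat_exp (n + 2) t + (- real n) * flat_exp (n + 1) t) * v)" for v
        by (intro Ck_on_mult Ck_on_add Ck_on_const Suc.IH) auto
    qed simp
  qed
  then show ?thesis by (simp add: smooth_on_def)
qed

lemma bump_function_exists:
  fixes x :: "'a::euclidean_space"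
  assumes "r > 0"
  shows "\<exists>\<beta> :: 'a \<Rightarrow> real. smooth_on UNIV \<beta> \<and> \<beta> x \<noteq> 0 \<and> (\<forall>y. y \<notin> cball x r \<longrightarrow> \<beta> y = 0)"
proof (intro exI conjI allI impI)
  \<comment> \<open>The argument \<open>r\<^sup>2\<close> minus the squared distance is positive
    exactly on the open ball. Writing the squared distance in coordinates reduces smoothness to that
    of a polynomial.\<close>
  let ?\<beta> = "\<lambda>y. flat_exp 0 (r\<^sup>2 - (\<Sum>i\<in>Basis. ((y - x) \<bullet> i) * ((y - x) \<bullet> i)))"
  have coord: "smooth_on UNIV (\<lambda>y. (y - x) \<bullet> i)" for i
    using smooth_on_add[OF open_UNIV smooth_on_linear[OF bounded_linear_inner_left[of i]]
        smooth_on_const[of UNIV "- (x \<bullet> i)"]] by (simp add: inner_diff_left)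
  have "smooth_on UNIV (\<lambda>y. r\<^sup>2 + (-1) * (\<Sum>i\<in>Basis. ((y - x) \<bullet> i) * ((y - x) \<bullet> i)))"
    by (intro smooth_on_add smooth_on_mult smooth_on_const smooth_on_sum open_UNIV coord)
  from smooth_on_compose[OF open_UNIV open_UNIV _ smooth_on_flat_exp[of 0] this]
  show "smooth_on UNIV ?\<beta>" by simp
  show "?\<beta> x \<noteq> 0" using assms by (simp add: flat_exp_def)
  show "?\<beta> y = 0" if "y \<notin> cball x r" for y
  proof -
    have "(\<Sum>i\<in>Basis. ((y - x) \<bullet> i) * ((y - x) \<bullet> i)) = (norm (y - x))\<^sup>2"
      by (simp add: euclidean_inner[symmetric] power2_norm_eq_inner)
    moreover have "r\<^sup>2 \<le> (norm (y - x))\<^sup>2"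
      using that assms by (intro power_mono) (auto simp: dist_norm norm_minus_commute)
    ultimately show ?thesis by (simp add: flat_exp_def)
  qed
qed


section \<open>Derivations and vector fields\<close>

locale smooth_manifold =
  fixes A :: "('g::topological_space, 'm::euclidean_space) chart set"
  assumes atlas: "smooth_atlas A"
begin

lemma chart_open: "(U, \<phi>) \<in> A \<Longrightarrow> open U"
  and chart_image_open: "(U, \<phi>) \<in> A \<Longrightarrow> open (\<phi> ` U)"
  and chart_homeomorphism: "(U, \<phi>) \<in> A \<Longrightarrow> homeomorphism U (\<phi> ` U) \<phi> (inv_into U \<phi>)"
  using atlas by (auto simp: smooth_atlas_def is_chart_def)

lemma chart_inv: "(U, \<phi>) \<in> A \<Longrightarrow> q \<in> U \<Longrightarrow> inv_into U \<phi> (\<phi> q) = q"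
  using chart_homeomorphism homeomorphism_apply1 by blast

lemma chart_subset_open:
  assumes "(U, \<phi>) \<in> A" "open V" "V \<subseteq> U"
  shows "open (\<phi> ` V)"
  using homeomorphism_imp_open_map[OF chart_homeomorphism[OF assms(1)], of V] assms
    chart_image_open[OF assms(1)]
  by (metis open_openin_trans openin_open_eq open_subset)

lemma chart_cover: obtains U \<phi> where "(U, \<phi>) \<in> A" "q \<in> U"
proof -
  have "q \<in> (\<Union>(U, \<phi>)\<in>A. U)" using atlas by (simp add: smooth_atlas_def)
  then show ?thesis using that by auto
qed

lemma smooth_functionsD:
  "f \<in> smooth_functions A \<Longrightarrow> (U, \<phi>) \<in> A \<Longrightarrow> smooth_on (\<phi> ` U) (\<lambda>x. f (inv_into U \<phi> x))"
  by (auto simp: smooth_functions_def comp_def)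

lemma smooth_functionsI:
  "(\<And>U \<phi>. (U, \<phi>) \<in> A \<Longrightarrow> smooth_on (\<phi> ` U) (\<lambda>x. f (inv_into U \<phi> x))) \<Longrightarrow> f \<in> smooth_functions A"
  by (auto simp: smooth_functions_def comp_def)

lemma smooth_const: "(\<lambda>_. c) \<in> smooth_functions A"
  by (intro smooth_functionsI smooth_on_const)

lemma smooth_add:
  "f \<in> smooth_functions A \<Longrightarrow> h \<in> smooth_functions A \<Longrightarrow> (\<lambda>x. f x + h x) \<in> smooth_functions A"
  by (auto intro!: smooth_functionsI smooth_on_add chart_image_open dest: smooth_functionsD)

lemma smooth_mult:
  "f \<in> smooth_functions A \<Longrightarrow> h \<in> smooth_functions A \<Longrightarrow> (\<lambda>x. f x * h x) \<in> smooth_functions A"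
  by (auto intro!: smooth_functionsI smooth_on_mult chart_image_open dest: smooth_functionsD)

lemma smooth_uminus: "f \<in> smooth_functions A \<Longrightarrow> (\<lambda>x. - f x) \<in> smooth_functions A"
  using smooth_mult[OF smooth_const, of f "-1"] by simp

lemma smooth_diff:
  "f \<in> smooth_functions A \<Longrightarrow> h \<in> smooth_functions A \<Longrightarrow> (\<lambda>x. f x - h x) \<in> smooth_functions A"
  using smooth_add[OF _ smooth_uminus, of f h] by simp

lemma smooth_sum:
  "(\<And>i. i \<in> I \<Longrightarrow> f i \<in> smooth_functions A) \<Longrightarrow> (\<lambda>x. \<Sum>i\<in>I. f i x) \<in> smooth_functions A"
  by (induction I rule: infinite_finite_induct) (auto intro: smooth_const smooth_add)

lemma tangent_nonsmooth: "v \<in> tangent_space A p \<Longrightarrow> f \<notin> smooth_functions A \<Longrightarrow> v f = 0"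
  by (simp add: tangent_space_def)

lemma tangent_mult:
  "v \<in> tangent_space A p \<Longrightarrow> f \<in> smooth_functions A \<Longrightarrow> h \<in> smooth_functions A \<Longrightarrow>
    v (\<lambda>x. f x * h x) = v f * h p + f p * v h"
  by (simp add: tangent_space_def)

lemma tangent_lincomb:
  "v \<in> tangent_space A p \<Longrightarrow> f \<in> smooth_functions A \<Longrightarrow> h \<in> smooth_functions A \<Longrightarrow>
    v (\<lambda>x. r * f x + s * h x) = r * v f + s * v h"
  by (simp add: tangent_space_def)

lemma tangent_add:
  "v \<in> tangent_space A p \<Longrightarrow> f \<in> smooth_functions A \<Longrightarrow> h \<in> smooth_functions A \<Longrightarrow>
    v (\<lambda>x. f x + h x) = v f + v h"
  using tangent_lincomb[of v p f h 1 1] by simp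

lemma tangent_diff:
  "v \<in> tangent_space A p \<Longrightarrow> f \<in> smooth_functions A \<Longrightarrow> h \<in> smooth_functions A \<Longrightarrow>
    v (\<lambda>x. f x - h x) = v f - v h"
  using tangent_lincomb[of v p f h 1 "-1"] by simp

lemma tangent_const: "v \<in> tangent_space A p \<Longrightarrow> v (\<lambda>_. c) = 0"
proof -
  assume v: "v \<in> tangent_space A p"
  \<comment> \<open>Leibniz for \<open>1 = 1 * 1\<close> gives \<open>v 1 = 2 * v 1\<close>.\<close>
  have "v (\<lambda>_. 1) = 0" using tangent_mult[OF v smooth_const smooth_const, of 1 1] by simp
  then show "v (\<lambda>_. c) = 0"
    using tangent_lincomb[OF v smooth_const smooth_const, of c 1 0 0] by simp
qed

lemma tangent_cmult: "v \<in> tangent_space A p \<Longrightarrow> f \<in> smooth_functions A \<Longrightarrow> v (\<lambda>x. c * f x) = c * v f"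
  using tangent_lincomb[of v p f f c 0] by simp

lemma tangent_uminus: "v \<in> tangent_space A p \<Longrightarrow> f \<in> smooth_functions A \<Longrightarrow> v (\<lambda>x. - f x) = - v f"
  using tangent_cmult[of v p f "-1"] by simp

lemma tangent_sum:
  assumes v: "v \<in> tangent_space A p" and f: "\<And>i. i \<in> I \<Longrightarrow> f i \<in> smooth_functions A"
  shows "v (\<lambda>x. \<Sum>i\<in>I. f i x) = (\<Sum>i\<in>I. v (f i))"
  using f
proof (induction I rule: infinite_finite_induct)
  case (insert i I)
  have "v (\<lambda>x. f i x + (\<Sum>j\<in>I. f j x)) = v (f i) + v (\<lambda>x. \<Sum>j\<in>I. f j x)"
    by (rule tangent_add[OF v]) (use insert.prems in \<open>auto intro: smooth_sum\<close>)
  then show ?case using insert by simp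
qed (simp_all add: tangent_const[OF v])

lemma tangent_spaceI:
  assumes "\<And>f. f \<notin> smooth_functions A \<Longrightarrow> v f = 0"
    and "\<And>f h r s. f \<in> smooth_functions A \<Longrightarrow> h \<in> smooth_functions A \<Longrightarrow>
        v (\<lambda>x. r * f x + s * h x) = r * v f + s * v h"
    and "\<And>f h. f \<in> smooth_functions A \<Longrightarrow> h \<in> smooth_functions A \<Longrightarrow>
        v (\<lambda>x. f x * h x) = v f * h p + f p * v h"
  shows "v \<in> tangent_space A p"
  using assms by (simp add: tangent_space_def)

lemma field_tangent: "X \<in> vector_fields A \<Longrightarrow> value_at X p \<in> tangent_space A p"
  and field_smooth: "X \<in> vector_fields A \<Longrightarrow> f \<in> smooth_functions A \<Longrightarrow> X f \<in> smooth_functions A"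
  by (auto simp: vector_fields_def)

lemma value_at_apply: "value_at X p f = X f p"
  by (simp add: value_at_def)

lemma field_nonsmooth: "X \<in> vector_fields A \<Longrightarrow> f \<notin> smooth_functions A \<Longrightarrow> X f = (\<lambda>_. 0)"
  using tangent_nonsmooth[OF field_tangent] by (auto simp: value_at_apply fun_eq_iff)

lemma
  assumes "X \<in> vector_fields A" "f \<in> smooth_functions A" "h \<in> smooth_functions A"
  shows field_lincomb: "X (\<lambda>x. r * f x + s * h x) = (\<lambda>p. r * X f p + s * X h p)"
    and field_add: "X (\<lambda>x. f x + h x) = (\<lambda>p. X f p + X h p)"
    and field_diff: "X (\<lambda>x. f x - h x) = (\<lambda>p. X f p - X h p)"
    and field_mult: "X (\<lambda>x. f x * h x) = (\<lambda>p. X f p * h p + f p * X h p)"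
proof -
  note X = field_tangent[OF assms(1)]
  show "X (\<lambda>x. r * f x + s * h x) = (\<lambda>p. r * X f p + s * X h p)"
    using tangent_lincomb[OF X assms(2,3), of _ r s] by (intro ext) (simp only: value_at_apply)
  show "X (\<lambda>x. f x + h x) = (\<lambda>p. X f p + X h p)"
    using tangent_add[OF X assms(2,3)] by (intro ext) (simp only: value_at_apply)
  show "X (\<lambda>x. f x - h x) = (\<lambda>p. X f p - X h p)"
    using tangent_diff[OF X assms(2,3)] by (intro ext) (simp only: value_at_apply)
  show "X (\<lambda>x. f x * h x) = (\<lambda>p. X f p * h p + f p * X h p)"
    using tangent_mult[OF X assms(2,3)] by (intro ext) (simp only: value_at_apply)
qed

lemma field_const: "X \<in> vector_fields A \<Longrightarrow> X (\<lambda>_. c) = (\<lambda>_. 0)"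
  using tangent_const[OF field_tangent] by (auto simp: value_at_apply fun_eq_iff)

lemma field_cmult:
  "X \<in> vector_fields A \<Longrightarrow> f \<in> smooth_functions A \<Longrightarrow> X (\<lambda>x. c * f x) = (\<lambda>p. c * X f p)"
  using tangent_cmult[OF field_tangent] by (auto simp: value_at_apply fun_eq_iff)

lemma field_uminus: "X \<in> vector_fields A \<Longrightarrow> f \<in> smooth_functions A \<Longrightarrow> X (\<lambda>x. - f x) = (\<lambda>p. - X f p)"
  using tangent_uminus[OF field_tangent] by (auto simp: value_at_apply fun_eq_iff)

lemma field_sum:
  assumes "X \<in> vector_fields A" "\<And>i. i \<in> I \<Longrightarrow> f i \<in> smooth_functions A"
  shows "X (\<lambda>x. \<Sum>i\<in>I. f i x) = (\<lambda>p. \<Sum>i\<in>I. X (f i) p)"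
proof
  show "X (\<lambda>x. \<Sum>i\<in>I. f i x) p = (\<Sum>i\<in>I. X (f i) p)" for p
    using tangent_sum[OF field_tangent[OF assms(1)], of I f p] assms(2) by (simp add: value_at_apply)
qed

lemma vector_fieldsI:
  assumes "\<And>p. value_at X p \<in> tangent_space A p"
    and "\<And>f. f \<in> smooth_functions A \<Longrightarrow> X f \<in> smooth_functions A"
  shows "X \<in> vector_fields A"
  using assms by (simp add: vector_fields_def)

lemma vector_fields_add:
  assumes X: "X \<in> vector_fields A" and Y: "Y \<in> vector_fields A"
  shows "X + Y \<in> vector_fields A"
proof (rule vector_fieldsI)
  show "value_at (X + Y) p \<in> tangent_space A p" for p
    using tangent_lincomb[OF field_tangent[OF X, of p]] tangent_lincomb[OF field_tangent[OF Y, of p]]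
      tangent_mult[OF field_tangent[OF X, of p]] tangent_mult[OF field_tangent[OF Y, of p]]
      field_nonsmooth[OF X] field_nonsmooth[OF Y]
    by (intro tangent_spaceI) (auto simp: value_at_apply algebra_simps)
  show "(X + Y) f \<in> smooth_functions A" if "f \<in> smooth_functions A" for f
    using smooth_add[OF field_smooth[OF X that] field_smooth[OF Y that]] by (simp add: plus_fun_def)
qed

lemma vector_fields_fscale:
  assumes X: "X \<in> vector_fields A" and h: "h \<in> smooth_functions A"
  shows "fscale h X \<in> vector_fields A"
proof (rule vector_fieldsI)
  show "value_at (fscale h X) p \<in> tangent_space A p" for p
    using tangent_lincomb[OF field_tangent[OF X, of p]]
      tangent_mult[OF field_tangent[OF X, of p]] field_nonsmooth[OF X]
    by (intro tangent_spaceI) (auto simp: value_at_apply algebra_simps fscale_def)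
  show "fscale h X f \<in> smooth_functions A" if "f \<in> smooth_functions A" for f
    using smooth_mult[OF h field_smooth[OF X that]] by (simp add: fscale_def)
qed

lemma vector_fields_zero: "0 \<in> vector_fields A"
  by (rule vector_fieldsI)
     (auto simp: value_at_apply zero_fun_def intro!: tangent_spaceI smooth_const)

lemma vector_fields_sum:
  "(\<And>i. i \<in> I \<Longrightarrow> X i \<in> vector_fields A) \<Longrightarrow> (\<Sum>i\<in>I. X i) \<in> vector_fields A"
  by (induction I rule: infinite_finite_induct) (auto intro: vector_fields_zero vector_fields_add)

text \<open>In the Leibniz rule the mixed products of \<open>X f\<close> with \<open>Y h\<close> and
  of \<open>Y f\<close> with \<open>X h\<close> occur in both iterated derivatives and cancel. On a
  non-smooth function each field returns the constant 0, which the other annihilates.\<close>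

lemma vector_fields_bracket:
  assumes X: "X \<in> vector_fields A" and Y: "Y \<in> vector_fields A"
  shows "bracket X Y \<in> vector_fields A"
proof (rule vector_fieldsI)
  show "value_at (bracket X Y) p \<in> tangent_space A p" for p
  proof (rule tangent_spaceI)
    fix f assume f: "f \<notin> smooth_functions A"
    show "value_at (bracket X Y) p f = 0"
      by (simp only: value_at_apply bracket_def field_nonsmooth[OF X f] field_nonsmooth[OF Y f]
          field_const[OF X] field_const[OF Y] diff_self)
  next
    fix f h :: "'g \<Rightarrow> real" and r s :: real
    assume fh: "f \<in> smooth_functions A" "h \<in> smooth_functions A"
    note sm = field_smooth[OF X fh(1)] field_smooth[OF X fh(2)] field_smooth[OF Y fh(1)] field_smooth[OF Y fh(2)]
    show "value_at (bracket X Y) p (\<lambda>x. r * f x + s * h x) =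
        r * value_at (bracket X Y) p f + s * value_at (bracket X Y) p h"
      by (simp only: value_at_apply bracket_def field_lincomb[OF X fh] field_lincomb[OF Y fh]
          field_lincomb[OF X sm(3,4)] field_lincomb[OF Y sm(1,2)], simp add: algebra_simps)
    show "value_at (bracket X Y) p (\<lambda>x. f x * h x) =
        value_at (bracket X Y) p f * h p + f p * value_at (bracket X Y) p h"
      by (simp only: value_at_apply bracket_def field_mult[OF X fh] field_mult[OF Y fh]
          field_add[OF X smooth_mult[OF sm(3) fh(2)] smooth_mult[OF fh(1) sm(4)]]
          field_add[OF Y smooth_mult[OF sm(1) fh(2)] smooth_mult[OF fh(1) sm(2)]]
          field_mult[OF X sm(3) fh(2)] field_mult[OF X fh(1) sm(4)]
          field_mult[OF Y sm(1) fh(2)] field_mult[OF Y fh(1) sm(2)], simp add: algebra_simps)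
  qed
  show "bracket X Y f \<in> smooth_functions A" if "f \<in> smooth_functions A" for f
    unfolding bracket_def
    by (rule smooth_diff[OF field_smooth[OF X field_smooth[OF Y that]] field_smooth[OF Y field_smooth[OF X that]]])
qed

end


section \<open>Smooth maps, products and Lie groups\<close>

text \<open>Around each point the chart domain is shrunk to the part that \<open>F\<close> maps into
  a chart \<open>V\<close>. This part is open because \<open>F\<close> is continuous, and there the
  composition factors as the chart expression of \<open>f\<close> after that of
  \<open>F\<close>.\<close>

lemma smooth_map_compose_function:
  assumes A: "smooth_atlas A" and B: "smooth_atlas B"
    and F: "smooth_map A B F" and f: "f \<in> smooth_functions B"
  shows "(\<lambda>x. f (F x)) \<in> smooth_functions A"
proof -
  interpret A: smooth_manifold A by (rule smooth_manifold.intro[OF A])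
  interpret B: smooth_manifold B by (rule smooth_manifold.intro[OF B])
  show ?thesis
  proof (rule A.smooth_functionsI, rule smooth_on_local)
    fix U \<phi> y assume U: "(U, \<phi>) \<in> A" and "y \<in> \<phi> ` U"
    then obtain q where q: "q \<in> U" "y = \<phi> q" by blast
    obtain V \<psi> where V: "(V, \<psi>) \<in> B" "F q \<in> V" by (rule B.chart_cover)
    let ?O = "U \<inter> F -` V"
    have "continuous_on UNIV F" using F by (simp add: smooth_map_def)
    then have "open ?O"
      using A.chart_open[OF U] B.chart_open[OF V(1)] by (simp add: open_Int open_vimage)
    then have O: "open (\<phi> ` ?O)" by (rule A.chart_subset_open[OF U]) simp
    have "smooth_on (\<phi> ` ?O) (\<lambda>x. \<psi> (F (inv_into U \<phi> x)))"
      using F U V(1) unfolding smooth_map_def comp_def by blast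
    moreover have "(\<lambda>x. \<psi> (F (inv_into U \<phi> x))) ` \<phi> ` ?O \<subseteq> \<psi> ` V"
      using A.chart_inv[OF U] by auto
    ultimately have "smooth_on (\<phi> ` ?O) (\<lambda>x. f (inv_into V \<psi> (\<psi> (F (inv_into U \<phi> x)))))"
      using smooth_on_compose[OF O B.chart_image_open[OF V(1)] _ B.smooth_functionsD[OF f V(1)]]
      by blast
    then have "smooth_on (\<phi> ` ?O) (\<lambda>x. f (F (inv_into U \<phi> x)))"
      by (rule smooth_on_cong[OF O, rotated]) (auto simp: A.chart_inv[OF U] B.chart_inv[OF V(1)])
    then show "\<exists>T. open T \<and> y \<in> T \<and> smooth_on T (\<lambda>x. f (F (inv_into U \<phi> x)))"
      using O q V(2) by blast
  qed
qed

lemma inv_into_map_prod: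
  assumes "inj_on \<phi> U" "inj_on \<psi> V" "x \<in> \<phi> ` U" "y \<in> \<psi> ` V"
  shows "inv_into (U \<times> V) (map_prod \<phi> \<psi>) (x, y) = (inv_into U \<phi> x, inv_into V \<psi> y)"
  using assms by (intro inv_into_f_eq map_prod_inj_on) (auto simp: f_inv_into_f inv_into_into)

lemma is_chart_product:
  assumes "is_chart (U, \<phi>)" "is_chart (V, \<psi>)"
  shows "is_chart (U \<times> V, map_prod \<phi> \<psi>)"
proof -
  have U: "open U" "open (\<phi> ` U)" "homeomorphism U (\<phi> ` U) \<phi> (inv_into U \<phi>)"
    and V: "open V" "open (\<psi> ` V)" "homeomorphism V (\<psi> ` V) \<psi> (inv_into V \<psi>)"
    using assms by (auto simp: is_chart_def)
  have inj: "inj_on \<phi> U" "inj_on \<psi> V"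
    using homeomorphism_apply1[OF U(3)] homeomorphism_apply1[OF V(3)] by (auto intro: inj_on_inverseI)
  have img: "map_prod \<phi> \<psi> ` (U \<times> V) = \<phi> ` U \<times> \<psi> ` V"
    by (rule map_prod_surj_on) auto
  have "homeomorphism (U \<times> V) (\<phi> ` U \<times> \<psi> ` V) (map_prod \<phi> \<psi>) (inv_into (U \<times> V) (map_prod \<phi> \<psi>))"
  proof (rule homeomorphismI)
    have "continuous_on (U \<times> V) (\<lambda>z. (\<phi> (fst z), \<psi> (snd z)))"
      using homeomorphism_cont1[OF U(3)] homeomorphism_cont1[OF V(3)]
      by (intro continuous_on_Pair continuous_on_compose2[of U \<phi> _ fst]
          continuous_on_compose2[of V \<psi> _ snd] continuous_on_fst continuous_on_snd continuous_on_id)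
        auto
    then show "continuous_on (U \<times> V) (map_prod \<phi> \<psi>)"
      by (simp add: map_prod_def case_prod_beta')
    have "continuous_on (\<phi> ` U \<times> \<psi> ` V) (\<lambda>z. (inv_into U \<phi> (fst z), inv_into V \<psi> (snd z)))"
      using homeomorphism_cont2[OF U(3)] homeomorphism_cont2[OF V(3)]
      by (intro continuous_on_Pair continuous_on_compose2[of "\<phi> ` U" "inv_into U \<phi>" _ fst]
          continuous_on_compose2[of "\<psi> ` V" "inv_into V \<psi>" _ snd]
          continuous_on_fst continuous_on_snd continuous_on_id) auto
    then show "continuous_on (\<phi> ` U \<times> \<psi> ` V) (inv_into (U \<times> V) (map_prod \<phi> \<psi>))"
      by (rule continuous_on_eq) (auto simp: inv_into_map_prod[OF inj])
    show "map_prod \<phi> \<psi> ` (U \<times> V) \<subseteq> \<phi> ` U \<times> \<psi> ` V" by (simp add: img)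
    show "inv_into (U \<times> V) (map_prod \<phi> \<psi>) ` (\<phi> ` U \<times> \<psi> ` V) \<subseteq> U \<times> V"
      using inv_into_into[of _ "map_prod \<phi> \<psi>" "U \<times> V"] img by blast
    show "inv_into (U \<times> V) (map_prod \<phi> \<psi>) (map_prod \<phi> \<psi> z) = z" if "z \<in> U \<times> V" for z
      by (rule inv_into_f_f[OF map_prod_inj_on[OF inj] that])
    show "map_prod \<phi> \<psi> (inv_into (U \<times> V) (map_prod \<phi> \<psi>) z) = z" if "z \<in> \<phi> ` U \<times> \<psi> ` V" for z
      by (rule f_inv_into_f) (use that img in blast)
  qed
  then show ?thesis
    using U(1,2) V(1,2) by (simp add: is_chart_def img open_Times)
qed

lemma smooth_on_Pair:
  assumes "open S" "smooth_on S f" "smooth_on S g"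
  shows "smooth_on S (\<lambda>x. (f x, g x))"
proof -
  have lin: "bounded_linear (\<lambda>a. (a, 0))" "bounded_linear (\<lambda>b. (0, b))"
    by (rule bounded_linear_Pair[OF bounded_linear_ident bounded_linear_zero],
        rule bounded_linear_Pair[OF bounded_linear_zero bounded_linear_ident])
  have "smooth_on S (\<lambda>x. (f x, 0) + (0, g x))"
    by (rule smooth_on_add[OF assms(1)
          smooth_on_compose[OF assms(1) open_UNIV subset_UNIV smooth_on_linear[OF lin(1)] assms(2)]
          smooth_on_compose[OF assms(1) open_UNIV subset_UNIV smooth_on_linear[OF lin(2)] assms(3)]])
  then show ?thesis by simp
qed

lemma smooth_on_map_prod:
  assumes "open S" "open T" "smooth_on S f" "smooth_on T g"
  shows "smooth_on (S \<times> T) (\<lambda>z. (f (fst z), g (snd z)))"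
proof -
  note ST = open_Times[OF assms(1,2)]
  have "smooth_on (S \<times> T) (\<lambda>z. f (fst z))"
    by (rule smooth_on_compose[OF ST assms(1) _ assms(3) smooth_on_linear[OF bounded_linear_fst]]) auto
  moreover have "smooth_on (S \<times> T) (\<lambda>z. g (snd z))"
    by (rule smooth_on_compose[OF ST assms(2) _ assms(4) smooth_on_linear[OF bounded_linear_snd]]) auto
  ultimately show ?thesis by (rule smooth_on_Pair[OF ST])
qed

text \<open>Smoothness of the group multiplication is stated over \<open>product_atlas\<close>, so
  the tools for manifolds must apply to it. Transition maps of product charts are products of
  transition maps.\<close>

lemma smooth_atlas_product:
  assumes "smooth_atlas A" "smooth_atlas B"
  shows "smooth_atlas (product_atlas A B)"
proof -
  interpret A: smooth_manifold A by (rule smooth_manifold.intro[OF assms(1)])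
  interpret B: smooth_manifold B by (rule smooth_manifold.intro[OF assms(2)])
  have chart: "is_chart c" if "c \<in> product_atlas A B" for c
    using that assms is_chart_product unfolding product_atlas_def smooth_atlas_def by blast
  have "\<exists>c\<in>product_atlas A B. z \<in> fst c" for z
  proof -
    obtain U \<phi> V \<psi> where "(U, \<phi>) \<in> A" "fst z \<in> U" "(V, \<psi>) \<in> B" "snd z \<in> V"
      using A.chart_cover[of "fst z"] B.chart_cover[of "snd z"] by metis
    then have "(U \<times> V, map_prod \<phi> \<psi>) \<in> product_atlas A B" "z \<in> U \<times> V"
      by (auto simp: product_atlas_def mem_Times_iff)
    then show ?thesis by (metis fst_conv)
  qed
  then have cover: "(\<Union>(U, \<phi>)\<in>product_atlas A B. U) = UNIV"
    by (fastforce simp: case_prod_beta')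
  have "smooth_on (map_prod \<phi> \<psi> ` (U \<times> V \<inter> U' \<times> V'))
      (map_prod \<phi>' \<psi>' \<circ> inv_into (U \<times> V) (map_prod \<phi> \<psi>))"
    if U: "(U, \<phi>) \<in> A" and V: "(V, \<psi>) \<in> B" and U': "(U', \<phi>') \<in> A" and V': "(V', \<psi>') \<in> B"
    for U \<phi> V \<psi> U' \<phi>' V' \<psi>'
  proof -
    let ?S = "\<phi> ` (U \<inter> U')" and ?T = "\<psi> ` (V \<inter> V')"
    have S: "open ?S" and T: "open ?T"
      using A.chart_subset_open[OF U] B.chart_subset_open[OF V] A.chart_open[OF U] A.chart_open[OF U']
        B.chart_open[OF V] B.chart_open[OF V'] by (auto simp: open_Int)
    have inj: "inj_on \<phi> U" "inj_on \<psi> V"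
      using A.chart_inv[OF U] B.chart_inv[OF V] by (auto intro: inj_on_inverseI)
    have img: "map_prod \<phi> \<psi> ` (U \<times> V \<inter> U' \<times> V') = ?S \<times> ?T"
      unfolding Times_Int_Times by (rule map_prod_surj_on) auto
    have "smooth_on ?S (\<phi>' \<circ> inv_into U \<phi>)" "smooth_on ?T (\<psi>' \<circ> inv_into V \<psi>)"
      using assms U V U' V' unfolding smooth_atlas_def by blast+
    from smooth_on_map_prod[OF S T this]
    have "smooth_on (?S \<times> ?T) (\<lambda>z. ((\<phi>' \<circ> inv_into U \<phi>) (fst z), (\<psi>' \<circ> inv_into V \<psi>) (snd z)))" .
    then show ?thesis
      unfolding img
      by (rule smooth_on_cong[rotated 2]) (use S T in \<open>auto simp: open_Times inv_into_map_prod[OF inj]\<close>)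
  qed
  then have "smooth_on (\<phi> ` (U \<inter> V)) (\<psi> \<circ> inv_into U \<phi>)"
    if "(U, \<phi>) \<in> product_atlas A B" "(V, \<psi>) \<in> product_atlas A B" for U \<phi> V \<psi>
    using that unfolding product_atlas_def by blast
  then show ?thesis using chart cover unfolding smooth_atlas_def by blast
qed

text \<open>Expresses smoothness on the product through the inverse charts of the two factors, where
  slices and partial derivatives can be taken.\<close>

lemma product_function_smooth:
  assumes "smooth_atlas A" "smooth_atlas B" "h \<in> smooth_functions (product_atlas A B)"
    and U: "(U, \<phi>) \<in> A" and V: "(V, \<psi>) \<in> B"
  shows "smooth_on (\<phi> ` U \<times> \<psi> ` V) (\<lambda>z. h (inv_into U \<phi> (fst z), inv_into V \<psi> (snd z)))"
proof -
  interpret A: smooth_manifold A by (rule smooth_manifold.intro[OF assms(1)])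
  interpret B: smooth_manifold B by (rule smooth_manifold.intro[OF assms(2)])
  interpret AB: smooth_manifold "product_atlas A B"
    by (rule smooth_manifold.intro[OF smooth_atlas_product[OF assms(1,2)]])
  have inj: "inj_on \<phi> U" "inj_on \<psi> V"
    using A.chart_inv[OF U] B.chart_inv[OF V] by (auto intro: inj_on_inverseI)
  have img: "map_prod \<phi> \<psi> ` (U \<times> V) = \<phi> ` U \<times> \<psi> ` V"
    by (rule map_prod_surj_on) auto
  have "(U \<times> V, map_prod \<phi> \<psi>) \<in> product_atlas A B"
    using U V unfolding product_atlas_def by blast
  from AB.smooth_functionsD[OF assms(3) this]
  have "smooth_on (\<phi> ` U \<times> \<psi> ` V) (\<lambda>z. h (inv_into (U \<times> V) (map_prod \<phi> \<psi>) z))"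
    unfolding img .
  then show ?thesis
    by (rule smooth_on_cong[rotated 2])
       (auto simp: open_Times A.chart_image_open[OF U] B.chart_image_open[OF V] inv_into_map_prod[OF inj])
qed

text \<open>A slice is a composition with a map that is constant in one component. Applied to
  \<open>f (x \<otimes> y)\<close>, it yields smoothness of the left and right translations.\<close>

lemma product_function_section:
  assumes "smooth_atlas A" "smooth_atlas B" "h \<in> smooth_functions (product_atlas A B)"
  shows "(\<lambda>q. h (x, q)) \<in> smooth_functions B" and "(\<lambda>p. h (p, y)) \<in> smooth_functions A"
proof -
  interpret A: smooth_manifold A by (rule smooth_manifold.intro[OF assms(1)])
  interpret B: smooth_manifold B by (rule smooth_manifold.intro[OF assms(2)])
  have id: "smooth_on S (\<lambda>x. x)" for S :: "'z::euclidean_space set"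
    by (rule smooth_on_linear[OF bounded_linear_ident])
  note op = open_Times[OF A.chart_image_open B.chart_image_open]
  show "(\<lambda>q. h (x, q)) \<in> smooth_functions B"
  proof (rule B.smooth_functionsI)
    fix V \<psi> assume V: "(V, \<psi>) \<in> B"
    obtain U \<phi> where U: "(U, \<phi>) \<in> A" "x \<in> U" by (rule A.chart_cover)
    have "smooth_on (\<psi> ` V) (\<lambda>z. (\<phi> x, z))"
      by (intro smooth_on_Pair smooth_on_const id B.chart_image_open[OF V])
    from smooth_on_compose[OF B.chart_image_open[OF V] op[OF U(1) V] _
        product_function_smooth[OF assms U(1) V] this]
    show "smooth_on (\<psi> ` V) (\<lambda>z. h (x, inv_into V \<psi> z))"
      using U(2) by (auto simp: A.chart_inv[OF U])
  qed
  show "(\<lambda>p. h (p, y)) \<in> smooth_functions A"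
  proof (rule A.smooth_functionsI)
    fix U \<phi> assume U: "(U, \<phi>) \<in> A"
    obtain V \<psi> where V: "(V, \<psi>) \<in> B" "y \<in> V" by (rule B.chart_cover)
    have "smooth_on (\<phi> ` U) (\<lambda>z. (z, \<psi> y))"
      by (intro smooth_on_Pair smooth_on_const id A.chart_image_open[OF U])
    from smooth_on_compose[OF A.chart_image_open[OF U] op[OF U V(1)] _
        product_function_smooth[OF assms U V(1)] this]
    show "smooth_on (\<phi> ` U) (\<lambda>z. h (inv_into U \<phi> z, y))"
      using V(2) by (auto simp: B.chart_inv[OF V])
  qed
qed

text \<open>A derivation sees \<open>F\<close> only through the pullback of functions, so smoothness
  of \<open>F\<close> is assumed in that form. It is applied to inversion, left translations and
  conjugations.\<close>

lemma (in smooth_manifold) tangent_pushforward: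
  assumes F: "\<And>f. f \<in> smooth_functions A \<Longrightarrow> (\<lambda>x. f (F x)) \<in> smooth_functions A"
    and v: "v \<in> tangent_space A p"
  shows "pushforward A F v \<in> tangent_space A (F p)"
proof (rule tangent_spaceI)
  show "pushforward A F v f = 0" if "f \<notin> smooth_functions A" for f
    using that by (simp add: pushforward_def)
  fix f h and r s :: real
  assume fh: "f \<in> smooth_functions A" "h \<in> smooth_functions A"
  have "(\<lambda>x. r * f x + s * h x) \<in> smooth_functions A"
    by (rule smooth_add[OF smooth_mult[OF smooth_const fh(1)] smooth_mult[OF smooth_const fh(2)]])
  then show "pushforward A F v (\<lambda>x. r * f x + s * h x) =
      r * pushforward A F v f + s * pushforward A F v h"
    using fh tangent_lincomb[OF v F[OF fh(1)] F[OF fh(2)], of r s]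
    by (simp add: pushforward_def comp_def)
  show "pushforward A F v (\<lambda>x. f x * h x) =
      pushforward A F v f * h (F p) + f (F p) * pushforward A F v h"
    using fh smooth_mult[OF fh] tangent_mult[OF v F[OF fh(1)] F[OF fh(2)]]
    by (simp add: pushforward_def comp_def)
qed

section \<open>Lie groups: smoothness of translations and inversion\<close>

locale Lie_group =
  fixes G :: "'g::{t2_space, second_countable_topology} monoid" (structure)
    and A :: "('g, 'm::euclidean_space) chart set"
  assumes lie_group: "lie_group G A"
begin

sublocale smooth_manifold A
  by unfold_locales (use lie_group in \<open>simp add: lie_group_def\<close>)

sublocale group G
  using lie_group by (simp add: lie_group_def)

lemma carrier_UNIV [simp]: "carrier G = UNIV"
  using lie_group by (simp add: lie_group_def)

lemma smooth_group_mult: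
  "f \<in> smooth_functions A \<Longrightarrow> (\<lambda>z. f (fst z \<otimes> snd z)) \<in> smooth_functions (product_atlas A A)"
  using smooth_map_compose_function[OF smooth_atlas_product[OF atlas atlas] atlas, of "\<lambda>(x, y). x \<otimes> y"]
    lie_group by (simp add: lie_group_def case_prod_beta')

lemma smooth_left_translation: "f \<in> smooth_functions A \<Longrightarrow> (\<lambda>q. f (x \<otimes> q)) \<in> smooth_functions A"
  and smooth_right_translation: "f \<in> smooth_functions A \<Longrightarrow> (\<lambda>q. f (q \<otimes> x)) \<in> smooth_functions A"
  using product_function_section[OF atlas atlas smooth_group_mult] by auto

lemma smooth_inversion: "f \<in> smooth_functions A \<Longrightarrow> (\<lambda>q. f (inv q)) \<in> smooth_functions A"
  using smooth_map_compose_function[OF atlas atlas] lie_group by (simp add: lie_group_def)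

end


section \<open>Tangent vectors as directional derivatives\<close>

text \<open>The value 0 on non-smooth functions matches the convention of
  \<open>tangent_space\<close>, so that derivations can be compared as functions.\<close>

definition chart_derivation ::
    "('g::topological_space, 'm::euclidean_space) chart set \<Rightarrow> 'g set \<Rightarrow> ('g \<Rightarrow> 'm) \<Rightarrow> 'g \<Rightarrow> 'm \<Rightarrow> 'g tangent"
  where
  "chart_derivation A U \<phi> p w = (\<lambda>f. if f \<in> smooth_functions A
     then frechet_derivative (\<lambda>x. f (inv_into U \<phi> x)) (at (\<phi> p)) w else 0)"

interpretation tangent: vector_space "tscale :: real \<Rightarrow> 'g tangent \<Rightarrow> 'g tangent"
  by (rule vector_space_tscale)

context smooth_manifold
begin

lemma chart_has_derivative:
  assumes "(U, \<phi>) \<in> A" "p \<in> U" "f \<in> smooth_functions A"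
  shows "((\<lambda>x. f (inv_into U \<phi> x)) has_derivative (\<lambda>w. chart_derivation A U \<phi> p w f)) (at (\<phi> p))"
  using has_derivative_frechet[OF smooth_on_imp_differentiable[OF smooth_functionsD[OF assms(3,1)]]]
    assms by (simp add: chart_derivation_def)

lemma chart_derivation_eqI:
  assumes "(U, \<phi>) \<in> A" "p \<in> U" "f \<in> smooth_functions A"
    and "((\<lambda>x. f (inv_into U \<phi> x)) has_derivative D) (at (\<phi> p))"
  shows "chart_derivation A U \<phi> p w f = D w"
  using frechet_derivativeI[OF assms(4)] assms(3) by (simp add: chart_derivation_def)

lemma chart_derivation_tangent:
  assumes "(U, \<phi>) \<in> A" "p \<in> U"
  shows "chart_derivation A U \<phi> p w \<in> tangent_space A p"
proof (rule tangent_spaceI)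
  show "chart_derivation A U \<phi> p w f = 0" if "f \<notin> smooth_functions A" for f
    using that by (simp add: chart_derivation_def)
  fix f h and r s :: real
  assume fh: "f \<in> smooth_functions A" "h \<in> smooth_functions A"
  note der = chart_has_derivative[OF assms fh(1)] chart_has_derivative[OF assms fh(2)]
  have "(\<lambda>x. r * f x + s * h x) \<in> smooth_functions A"
    by (rule smooth_add[OF smooth_mult[OF smooth_const fh(1)] smooth_mult[OF smooth_const fh(2)]])
  then show "chart_derivation A U \<phi> p w (\<lambda>x. r * f x + s * h x) =
      r * chart_derivation A U \<phi> p w f + s * chart_derivation A U \<phi> p w h"
    by (rule chart_derivation_eqI[OF assms]) (intro has_derivative_add has_derivative_mult_right der)
  have "chart_derivation A U \<phi> p w (\<lambda>x. f x * h x) =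
      f (inv_into U \<phi> (\<phi> p)) * chart_derivation A U \<phi> p w h +
      chart_derivation A U \<phi> p w f * h (inv_into U \<phi> (\<phi> p))"
    by (rule chart_derivation_eqI[OF assms smooth_mult[OF fh]]) (rule has_derivative_mult[OF der])
  then show "chart_derivation A U \<phi> p w (\<lambda>x. f x * h x) =
      chart_derivation A U \<phi> p w f * h p + f p * chart_derivation A U \<phi> p w h"
    by (simp add: chart_inv[OF assms])
qed

lemma chart_derivation_linear:
  assumes "(U, \<phi>) \<in> A" "p \<in> U"
  shows "chart_derivation A U \<phi> p (w + z) = chart_derivation A U \<phi> p w + chart_derivation A U \<phi> p z"
    and "chart_derivation A U \<phi> p (r *\<^sub>R w) = tscale r (chart_derivation A U \<phi> p w)"
proof -
  have lin: "linear (\<lambda>w. chart_derivation A U \<phi> p w f)" if "f \<in> smooth_functions A" for f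
    using has_derivative_linear[OF chart_has_derivative[OF assms that]] .
  show "chart_derivation A U \<phi> p (w + z) = chart_derivation A U \<phi> p w + chart_derivation A U \<phi> p z"
  proof
    show "chart_derivation A U \<phi> p (w + z) f =
        (chart_derivation A U \<phi> p w + chart_derivation A U \<phi> p z) f" for f
      using linear_add[OF lin, of f w z]
      by (cases "f \<in> smooth_functions A") (simp_all add: chart_derivation_def)
  qed
  show "chart_derivation A U \<phi> p (r *\<^sub>R w) = tscale r (chart_derivation A U \<phi> p w)"
  proof
    show "chart_derivation A U \<phi> p (r *\<^sub>R w) f = tscale r (chart_derivation A U \<phi> p w) f" for f
      using linear_cmul[OF lin, of f r w]
      by (cases "f \<in> smooth_functions A") (simp_all add: chart_derivation_def tscale_def)
  qed
qed

end

text \<open>On \<open>U\<close> the function is \<open>\<eta> \<circ> \<phi>\<close>; off the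
  preimage of \<open>K\<close> it vanishes. These two sets cover the manifold, and the second is
  open because a compact set in a Hausdorff space is closed.\<close>

lemma extend_by_zero_smooth:
  fixes A :: "('g::t2_space, 'm::euclidean_space) chart set" and \<eta> :: "'m \<Rightarrow> real"
  assumes "smooth_atlas A" and U: "(U, \<phi>) \<in> A"
    and K: "compact K" "K \<subseteq> \<phi> ` U" and \<eta>: "smooth_on UNIV \<eta>" "\<And>y. y \<notin> K \<Longrightarrow> \<eta> y = 0"
  shows "(\<lambda>q. if q \<in> U then \<eta> (\<phi> q) else 0) \<in> smooth_functions A"
proof -
  interpret smooth_manifold A by (rule smooth_manifold.intro[OF assms(1)])
  let ?f = "\<lambda>q. if q \<in> U then \<eta> (\<phi> q) else 0"
  let ?L = "inv_into U \<phi> ` K"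
  have "compact ?L"
    using K continuous_on_subset[OF homeomorphism_cont2[OF chart_homeomorphism[OF U]]]
    by (intro compact_continuous_image)
  then have L: "closed ?L" by (rule compact_imp_closed)
  have f0: "?f q = 0" if "q \<notin> ?L" for q
  proof (cases "q \<in> U")
    case True
    then have "\<phi> q \<notin> K" using that chart_inv[OF U True] by (metis imageI)
    then show ?thesis using \<eta>(2) by simp
  qed simp
  show ?thesis
  proof (rule smooth_functionsI, rule smooth_on_local)
    fix V \<psi> y assume V: "(V, \<psi>) \<in> A" and "y \<in> \<psi> ` V"
    then obtain q where q: "q \<in> V" "y = \<psi> q" by blast
    show "\<exists>T. open T \<and> y \<in> T \<and> smooth_on T (\<lambda>x. ?f (inv_into V \<psi> x))"
    proof (cases "q \<in> U")
      case True
      let ?T = "\<psi> ` (V \<inter> U)"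
      have T: "open ?T"
        using chart_subset_open[OF V] chart_open[OF U] chart_open[OF V] by (simp add: open_Int)
      have "smooth_on ?T (\<phi> \<circ> inv_into V \<psi>)"
        using assms(1) U V unfolding smooth_atlas_def by blast
      from smooth_on_compose[OF T open_UNIV subset_UNIV \<eta>(1) this]
      have "smooth_on ?T (\<lambda>x. ?f (inv_into V \<psi> x))"
        by (rule smooth_on_cong[OF T, rotated]) (auto simp: chart_inv[OF V])
      then show ?thesis using T True q by blast
    next
      case False
      let ?T = "\<psi> ` (V - ?L)"
      have T: "open ?T"
        using chart_subset_open[OF V] L chart_open[OF V] by (simp add: open_Diff)
      have "q \<notin> ?L" using False K(2) inv_into_into[of _ \<phi> U] by blast
      moreover have "smooth_on ?T (\<lambda>x. ?f (inv_into V \<psi> x))"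
      proof (rule smooth_on_cong[OF T _ smooth_on_const[of _ 0]])
        fix x assume "x \<in> ?T"
        then have "inv_into V \<psi> x \<notin> ?L" using chart_inv[OF V] by force
        then show "0 = ?f (inv_into V \<psi> x)" using f0 by metis
      qed
      ultimately show ?thesis using T q by blast
    qed
  qed
qed

text \<open>A chart coordinate is not a global function, so it is cut off by a bump. Because the
  coordinate is centred at \<open>\<phi> p\<close>, the derivative of the bump drops out of the
  product rule; the value of the bump at \<open>\<phi> p\<close> is the constant
  \<open>c\<close>.\<close>

lemma coordinate_function_exists:
  fixes A :: "('g::t2_space, 'm::euclidean_space) chart set"
  assumes "smooth_atlas A" and U: "(U, \<phi>) \<in> A" "p \<in> U"
  obtains f c where "f \<in> smooth_functions A" "c \<noteq> 0"
    "\<And>w. chart_derivation A U \<phi> p w f = c * (w \<bullet> b)"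
proof -
  interpret smooth_manifold A by (rule smooth_manifold.intro[OF assms(1)])
  obtain r where r: "r > 0" "cball (\<phi> p) r \<subseteq> \<phi> ` U"
    using open_contains_cball[THEN iffD1, OF chart_image_open[OF U(1)]] U(2) by auto
  obtain \<beta> :: "'m \<Rightarrow> real" where \<beta>: "smooth_on UNIV \<beta>" "\<beta> (\<phi> p) \<noteq> 0" "\<And>y. y \<notin> cball (\<phi> p) r \<Longrightarrow> \<beta> y = 0"
    using bump_function_exists[OF r(1), of "\<phi> p"] by blast
  let ?\<eta> = "\<lambda>y. (y \<bullet> b - \<phi> p \<bullet> b) * \<beta> y"
  let ?f = "\<lambda>q. if q \<in> U then ?\<eta> (\<phi> q) else 0"
  have "smooth_on UNIV (\<lambda>y. y \<bullet> b + - (\<phi> p \<bullet> b))"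
    by (rule smooth_on_add[OF open_UNIV smooth_on_linear[OF bounded_linear_inner_left] smooth_on_const])
  then have "smooth_on UNIV (\<lambda>y. y \<bullet> b - \<phi> p \<bullet> b)" by simp
  then have \<eta>: "smooth_on UNIV ?\<eta>" by (rule smooth_on_mult[OF open_UNIV _ \<beta>(1)])
  have f: "?f \<in> smooth_functions A"
    by (rule extend_by_zero_smooth[OF assms(1) U(1) compact_cball r(2) \<eta>]) (simp add: \<beta>(3))
  have "(\<beta> has_derivative frechet_derivative \<beta> (at (\<phi> p))) (at (\<phi> p))"
    by (rule has_derivative_frechet[OF smooth_on_imp_differentiable[OF \<beta>(1)]]) simp
  moreover have "((\<lambda>y. y \<bullet> b - \<phi> p \<bullet> b) has_derivative (\<lambda>w. w \<bullet> b - 0)) (at (\<phi> p))"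
    by (intro has_derivative_diff has_derivative_const
        bounded_linear_imp_has_derivative[OF bounded_linear_inner_left])
  then have "((\<lambda>y. y \<bullet> b - \<phi> p \<bullet> b) has_derivative (\<lambda>w. w \<bullet> b)) (at (\<phi> p))" by simp
  ultimately have "(?\<eta> has_derivative (\<lambda>w. (\<phi> p \<bullet> b - \<phi> p \<bullet> b) * frechet_derivative \<beta> (at (\<phi> p)) w
      + (w \<bullet> b) * \<beta> (\<phi> p))) (at (\<phi> p))"
    by (rule has_derivative_mult[rotated])
  then have "(?\<eta> has_derivative (\<lambda>w. \<beta> (\<phi> p) * (w \<bullet> b))) (at (\<phi> p))"
    by (simp add: mult.commute)
  then have "((\<lambda>x. ?f (inv_into U \<phi> x)) has_derivative (\<lambda>w. \<beta> (\<phi> p) * (w \<bullet> b))) (at (\<phi> p))"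
    by (rule has_derivative_transform_within_open[OF _ chart_image_open[OF U(1)]])
       (use U in \<open>auto simp: chart_inv[OF U(1)]\<close>)
  then have "chart_derivation A U \<phi> p w ?f = \<beta> (\<phi> p) * (w \<bullet> b)" for w
    by (rule chart_derivation_eqI[OF U f])
  then show thesis by (rule that[OF f \<beta>(2)])
qed

text \<open>A dimension count replaces Hadamard's lemma: the coordinate derivations are independent, and the
  tangent space is assumed to be spanned by at most as many vectors.\<close>

lemma tangent_space_chart_derivation:
  fixes A :: "('g::t2_space, 'm::euclidean_space) chart set"
  assumes "smooth_atlas A" and U: "(U, \<phi>) \<in> A" "p \<in> U"
    and S: "finite S" "card S \<le> DIM('m)" "tangent_space A p \<subseteq> tangent_span S"
    and v: "v \<in> tangent_space A p"
  obtains w where "v = chart_derivation A U \<phi> p w"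
proof -
  interpret smooth_manifold A by (rule smooth_manifold.intro[OF assms(1)])
  let ?d = "chart_derivation A U \<phi> p"
  let ?B = "?d ` Basis"
  \<comment> \<open>On the cut-off coordinate along \<open>b\<close>, the only nonzero basis
    derivation is \<open>?d b\<close>; this gives both injectivity and independence.\<close>
  have sep: "\<exists>f. ?d b f \<noteq> 0 \<and> (\<forall>b'\<in>Basis - {b}. ?d b' f = 0)" if b: "b \<in> Basis" for b
  proof -
    obtain f c where "f \<in> smooth_functions A" "c \<noteq> 0" "\<And>w. ?d w f = c * (w \<bullet> b)"
      using coordinate_function_exists[OF assms(1) U] by metis
    then show ?thesis using b by (intro exI[of _ f]) (auto simp: inner_Basis)
  qed
  have inj: "inj_on ?d Basis"
    using sep by (metis DiffI empty_iff inj_onI insert_iff)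
  have indep: "\<not> tangent.dependent ?B"
    unfolding tangent.dependent_def
  proof
    assume "\<exists>a\<in>?B. a \<in> tangent.span (?B - {a})"
    then obtain b where b: "b \<in> Basis" "?d b \<in> tangent.span (?B - {?d b})" by blast
    obtain f where f: "?d b f \<noteq> 0" "\<forall>b'\<in>Basis - {b}. ?d b' f = 0" using sep[OF b(1)] by blast
    have "tangent.span (?B - {?d b}) \<subseteq> {v. v f = 0}"
      by (rule tangent.span_minimal) (use f in \<open>auto simp: tangent.subspace_def tscale_def\<close>)
    then show False using b f(1) by blast
  qed
  have "v \<in> tangent.span ?B"
  proof (rule ccontr)
    assume nv: "v \<notin> tangent.span ?B"
    then have "\<not> tangent.dependent (insert v ?B)" using indep by (rule tangent.independent_insertI)
    moreover have "insert v ?B \<subseteq> tangent.span S"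
      using S(3) v chart_derivation_tangent[OF U] by auto
    ultimately have "card (insert v ?B) \<le> card S"
      using tangent.independent_span_bound[OF S(1)] by blast
    moreover have "v \<notin> ?B" using nv tangent.span_base by blast
    ultimately show False using S(2) by (simp add: card_image[OF inj])
  qed
  moreover have "tangent.span ?B \<subseteq> range ?d"
  proof (rule tangent.span_minimal)
    show "tangent.subspace (range ?d)"
      unfolding tangent.subspace_def
    proof (intro conjI ballI allI)
      show "0 \<in> range ?d"
      proof (rule range_eqI)
        show "0 = ?d 0"
          using chart_derivation_linear(2)[OF U, of 0 0] by (simp add: tscale_def zero_fun_def)
      qed
      show "x + y \<in> range ?d" if "x \<in> range ?d" "y \<in> range ?d" for x y
        using that by (auto simp: chart_derivation_linear(1)[OF U, symmetric])
      show "tscale c x \<in> range ?d" if "x \<in> range ?d" for c x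
        using that by (auto simp: chart_derivation_linear(2)[OF U, symmetric])
    qed
  qed auto
  ultimately show thesis using that by blast
qed

lemma has_derivative_sections:
  assumes "f differentiable (at (x, y))"
  shows "((\<lambda>y. f (x, y)) has_derivative (\<lambda>v. frechet_derivative f (at (x, y)) (0, v))) (at y)"
    and "((\<lambda>x. f (x, y)) has_derivative (\<lambda>u. frechet_derivative f (at (x, y)) (u, 0))) (at x)"
proof -
  have "((\<lambda>y. (x, y)) has_derivative (\<lambda>v. (0, v))) (at y)"
    by (auto intro!: derivative_eq_intros)
  from has_derivative_compose[OF this has_derivative_frechet[OF assms]]
  show "((\<lambda>y. f (x, y)) has_derivative (\<lambda>v. frechet_derivative f (at (x, y)) (0, v))) (at y)" .
  have "((\<lambda>x. (x, y)) has_derivative (\<lambda>u. (u, 0))) (at x)"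
    by (auto intro!: derivative_eq_intros)
  from has_derivative_compose[OF this has_derivative_frechet[OF assms]]
  show "((\<lambda>x. f (x, y)) has_derivative (\<lambda>u. frechet_derivative f (at (x, y)) (u, 0))) (at x)" .
qed

text \<open>In product charts both sides are second derivatives of one function along
  \<open>(w, 0)\<close> and \<open>(0, z)\<close>. Since \<open>chart_derivation\<close> is 0 by
  convention on non-smooth functions, \<open>s1\<close> and \<open>s2\<close> guarantee that the
  outer derivations are true derivatives; for invariant fields they come from
  \<open>field_smooth\<close>.\<close>

lemma chart_derivations_commute:
  assumes "smooth_atlas A" "smooth_atlas B" and h: "h \<in> smooth_functions (product_atlas A B)"
    and U: "(U, \<phi>) \<in> A" "p \<in> U" and V: "(V, \<psi>) \<in> B" "q \<in> V"
    and s1: "(\<lambda>x. chart_derivation B V \<psi> q z (\<lambda>y. h (x, y))) \<in> smooth_functions A"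
    and s2: "(\<lambda>y. chart_derivation A U \<phi> p w (\<lambda>x. h (x, y))) \<in> smooth_functions B"
  shows "chart_derivation A U \<phi> p w (\<lambda>x. chart_derivation B V \<psi> q z (\<lambda>y. h (x, y))) =
         chart_derivation B V \<psi> q z (\<lambda>y. chart_derivation A U \<phi> p w (\<lambda>x. h (x, y)))"
proof -
  interpret A: smooth_manifold A by (rule smooth_manifold.intro[OF assms(1)])
  interpret B: smooth_manifold B by (rule smooth_manifold.intro[OF assms(2)])
  let ?P = "\<phi> ` U" and ?Q = "\<psi> ` V"
  let ?H = "\<lambda>z. h (inv_into U \<phi> (fst z), inv_into V \<psi> (snd z))"
  note slice = product_function_section[OF assms(1-3)]
  have PQ: "open ?P" "open ?Q" "open (?P \<times> ?Q)"
    using A.chart_image_open[OF U(1)] B.chart_image_open[OF V(1)] by (auto intro: open_Times)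
  have H: "smooth_on (?P \<times> ?Q) ?H" by (rule product_function_smooth[OF assms(1-3) U(1) V(1)])
  have dH: "?H differentiable (at (x, y))" if "x \<in> ?P" "y \<in> ?Q" for x y
    by (rule smooth_on_imp_differentiable[OF H]) (use that in auto)
  have dH': "(\<lambda>\<zeta>. frechet_derivative ?H (at \<zeta>) u) differentiable (at (\<phi> p, \<psi> q))" for u
    by (rule smooth_on_imp_differentiable[OF smooth_on_frechet_derivative[OF H]]) (use U V in auto)
  have inner1: "chart_derivation B V \<psi> q z (\<lambda>y. h (inv_into U \<phi> x, y)) =
      frechet_derivative ?H (at (x, \<psi> q)) (0, z)" if "x \<in> ?P" for x
    by (rule B.chart_derivation_eqI[OF V slice(1)])
       (use has_derivative_sections(1)[OF dH[OF that]] V in simp)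
  have inner2: "chart_derivation A U \<phi> p w (\<lambda>x. h (x, inv_into V \<psi> y)) =
      frechet_derivative ?H (at (\<phi> p, y)) (w, 0)" if "y \<in> ?Q" for y
    by (rule A.chart_derivation_eqI[OF U slice(2)])
       (use has_derivative_sections(2)[OF dH[OF _ that]] U in simp)
  have "((\<lambda>x. chart_derivation B V \<psi> q z (\<lambda>y. h (inv_into U \<phi> x, y))) has_derivative
      (\<lambda>u. frechet_derivative (\<lambda>\<zeta>. frechet_derivative ?H (at \<zeta>) (0, z)) (at (\<phi> p, \<psi> q)) (u, 0))) (at (\<phi> p))"
    by (rule has_derivative_transform_within_open[OF has_derivative_sections(2)[OF dH'] PQ(1)])
       (use U inner1 in auto)
  then have "chart_derivation A U \<phi> p w (\<lambda>x. chart_derivation B V \<psi> q z (\<lambda>y. h (x, y))) =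
      frechet_derivative (\<lambda>\<zeta>. frechet_derivative ?H (at \<zeta>) (0, z)) (at (\<phi> p, \<psi> q)) (w, 0)"
    by (rule A.chart_derivation_eqI[OF U s1])
  moreover have "((\<lambda>y. chart_derivation A U \<phi> p w (\<lambda>x. h (x, inv_into V \<psi> y))) has_derivative
      (\<lambda>v. frechet_derivative (\<lambda>\<zeta>. frechet_derivative ?H (at \<zeta>) (w, 0)) (at (\<phi> p, \<psi> q)) (0, v))) (at (\<psi> q))"
    by (rule has_derivative_transform_within_open[OF has_derivative_sections(1)[OF dH'] PQ(2)])
       (use V inner2 in auto)
  then have "chart_derivation B V \<psi> q z (\<lambda>y. chart_derivation A U \<phi> p w (\<lambda>x. h (x, y))) =
      frechet_derivative (\<lambda>\<zeta>. frechet_derivative ?H (at \<zeta>) (w, 0)) (at (\<phi> p, \<psi> q)) (0, z)"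
    by (rule B.chart_derivation_eqI[OF V s2])
  moreover have "(\<phi> p, \<psi> q) \<in> ?P \<times> ?Q" using U V by simp
  ultimately show ?thesis
    using second_derivative_symmetric[OF PQ(3) _ H, of "(\<phi> p, \<psi> q)" "(0, z)" "(w, 0)"] by simp
qed


section \<open>Orthonormal frames\<close>

lemma sum_field_apply: "(\<Sum>i\<in>I. X i) f p = (\<Sum>i\<in>I. X i f p)" for X :: "'i \<Rightarrow> 'g vfield"
  by (induction I rule: infinite_finite_induct) auto

text \<open>Arranged so that for frame fields \<open>Y\<close>, \<open>Z\<close> both terms on the
  right are brackets with a frame field in the second place, the shape that
  \<open>component_bracket_frame\<close> computes.\<close>

lemma (in smooth_manifold) jacobi_bracket:
  assumes X: "X \<in> vector_fields A" and Y: "Y \<in> vector_fields A" and Z: "Z \<in> vector_fields A"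
    and f: "f \<in> smooth_functions A"
  shows "bracket X (bracket Y Z) f p = bracket (bracket X Y) Z f p - bracket (bracket X Z) Y f p"
proof -
  note s = field_smooth[OF X] field_smooth[OF Y] field_smooth[OF Z]
  note d = field_diff[OF X s(2)[OF s(3)[OF f]] s(3)[OF s(2)[OF f]]]
    field_diff[OF Z s(1)[OF s(2)[OF f]] s(2)[OF s(1)[OF f]]]
    field_diff[OF Y s(1)[OF s(3)[OF f]] s(3)[OF s(1)[OF f]]]
  show ?thesis unfolding bracket_def d by simp
qed

text \<open>Spanning is stated by coefficients that serve all \<open>f\<close> at once, since these
  are what the metric reads off. The frame is global, so every field is encoded by globally smooth
  functions.\<close>

locale orthonormal_frame = smooth_manifold A
  for A :: "('g::topological_space, 'm::euclidean_space) chart set" +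
  fixes g :: "'g metric_tensor" and E :: "'i::finite \<Rightarrow> 'g vfield"
  assumes riemannian: "riemannian_metric A g"
    and frame: "\<And>i. E i \<in> vector_fields A"
    and orthonormal: "\<And>p i j. g p (value_at (E i) p) (value_at (E j) p) = (if i = j then 1 else 0)"
    and spanning: "\<And>p v. v \<in> tangent_space A p \<Longrightarrow> \<exists>c. \<forall>f. v f = (\<Sum>i\<in>UNIV. c i * E i f p)"
begin

definition component :: "'g vfield \<Rightarrow> 'i \<Rightarrow> 'g \<Rightarrow> real" where
  "component X i = metric_on_fields g X (E i)"

lemma metric_lincomb:
  "u \<in> tangent_space A p \<Longrightarrow> v \<in> tangent_space A p \<Longrightarrow> w \<in> tangent_space A p \<Longrightarrow>
    g p (tscale r u + tscale s v) w = r * g p u w + s * g p v w"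
  using riemannian by (simp add: riemannian_metric_def)

lemma metric_sym:
  "u \<in> tangent_space A p \<Longrightarrow> v \<in> tangent_space A p \<Longrightarrow> g p u v = g p v u"
  using riemannian by (simp add: riemannian_metric_def)

lemma component_smooth: "X \<in> vector_fields A \<Longrightarrow> component X i \<in> smooth_functions A"
  using riemannian frame by (simp add: riemannian_metric_def component_def)

text \<open>\<open>riemannian_metric\<close> gives linearity only for two summands from the tangent
  space, so the induction has to carry membership of the partial sums along.\<close>

lemma metric_sum:
  assumes "finite I" "w \<in> tangent_space A p"
  shows "(\<lambda>f. \<Sum>i\<in>I. c i * E i f p) \<in> tangent_space A p \<and>
    g p (\<lambda>f. \<Sum>i\<in>I. c i * E i f p) w = (\<Sum>i\<in>I. c i * g p (value_at (E i) p) w)"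
  using assms(1)
proof (induction I)
  case empty
  have "g p (tscale 0 w + tscale 0 w) w = 0" using metric_lincomb[OF assms(2,2,2), of 0 0] by simp
  moreover have "tscale 0 w + tscale 0 w = (\<lambda>f. 0)" by (simp add: tscale_def fun_eq_iff)
  moreover have "(\<lambda>f. 0) \<in> tangent_space A p" by (rule tangent_spaceI) auto
  ultimately show ?case by simp
next
  case (insert i I)
  let ?v = "\<lambda>f. \<Sum>i\<in>I. c i * E i f p"
  have eq: "(\<lambda>f. \<Sum>i\<in>insert i I. c i * E i f p) = tscale (c i) (value_at (E i) p) + tscale 1 ?v"
    using insert by (simp add: fun_eq_iff tscale_def value_at_apply)
  have Ei: "value_at (E i) p \<in> tangent_space A p" by (rule field_tangent[OF frame])
  have "tscale (c i) (value_at (E i) p) + tscale 1 ?v \<in> tangent_space A p"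
  proof (rule tangent_spaceI)
    show "(tscale (c i) (value_at (E i) p) + tscale 1 ?v) f = 0" if "f \<notin> smooth_functions A" for f
      using tangent_nonsmooth[OF Ei that] tangent_nonsmooth[OF conjunct1[OF insert.IH] that]
      by (simp add: tscale_def)
    fix f h and r s :: real
    assume fh: "f \<in> smooth_functions A" "h \<in> smooth_functions A"
    show "(tscale (c i) (value_at (E i) p) + tscale 1 ?v) (\<lambda>x. r * f x + s * h x) =
       r * (tscale (c i) (value_at (E i) p) + tscale 1 ?v) f + s * (tscale (c i) (value_at (E i) p) + tscale 1 ?v) h"
      using tangent_lincomb[OF Ei fh, of r s] tangent_lincomb[OF conjunct1[OF insert.IH] fh, of r s]
      by (simp add: tscale_def algebra_simps)
    show "(tscale (c i) (value_at (E i) p) + tscale 1 ?v) (\<lambda>x. f x * h x) =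
       (tscale (c i) (value_at (E i) p) + tscale 1 ?v) f * h p + f p * (tscale (c i) (value_at (E i) p) + tscale 1 ?v) h"
      using tangent_mult[OF Ei fh] tangent_mult[OF conjunct1[OF insert.IH] fh]
      by (simp add: tscale_def algebra_simps)
  qed
  moreover have "g p (tscale (c i) (value_at (E i) p) + tscale 1 ?v) w =
      c i * g p (value_at (E i) p) w + (\<Sum>i\<in>I. c i * g p (value_at (E i) p) w)"
    using metric_lincomb[OF Ei conjunct1[OF insert.IH] assms(2), of "c i" 1] insert.IH by simp
  ultimately show ?case using insert.hyps unfolding eq by simp
qed

lemma metric_frame_sum:
  "w \<in> tangent_space A p \<Longrightarrow>
    g p (\<lambda>f. \<Sum>i\<in>UNIV. c i * E i f p) w = (\<Sum>i\<in>UNIV. c i * g p (value_at (E i) p) w)"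
  using metric_sum[of UNIV w p c] by simp

lemma frame_coefficients:
  "g p (\<lambda>f. \<Sum>i\<in>UNIV. c i * E i f p) (value_at (E j) p) = c j"
  by (simp add: metric_frame_sum[OF field_tangent[OF frame]] orthonormal if_distrib[of "\<lambda>x. _ * x"]
      cong: if_cong)

lemma tangent_expansion:
  assumes "v \<in> tangent_space A p"
  shows "v = (\<lambda>f. \<Sum>i\<in>UNIV. g p v (value_at (E i) p) * E i f p)"
proof -
  obtain c where c: "v = (\<lambda>f. \<Sum>i\<in>UNIV. c i * E i f p)" using spanning[OF assms] by blast
  then have "g p v (value_at (E i) p) = c i" for i
    using frame_coefficients by simp
  then show ?thesis using c by simp
qed

lemma component_apply: "component X i p = g p (value_at X p) (value_at (E i) p)"
  by (simp add: component_def metric_on_fields_def)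

lemma field_expansion:
  "X \<in> vector_fields A \<Longrightarrow> X f p = (\<Sum>i\<in>UNIV. component X i p * E i f p)"
  using fun_cong[OF tangent_expansion[OF field_tangent, of X p], of f]
  by (simp add: component_apply value_at_apply)

lemma field_expansion_fscale:
  "X \<in> vector_fields A \<Longrightarrow> X = (\<Sum>i\<in>UNIV. fscale (component X i) (E i))"
  by (intro ext) (simp add: sum_field_apply fscale_def field_expansion)

text \<open>Testing on smooth functions suffices because fields vanish on all others. Only the point
  \<open>p\<close> is involved, so the coefficients may be chosen for \<open>p\<close>
  alone.\<close>

lemma component_unique:
  assumes "X \<in> vector_fields A" "\<And>f. f \<in> smooth_functions A \<Longrightarrow> X f p = (\<Sum>i\<in>UNIV. c i * E i f p)"
  shows "component X i p = c i"
proof -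
  have "X f p = (\<Sum>i\<in>UNIV. c i * E i f p)" for f
    using assms field_nonsmooth[OF assms(1), of f] field_nonsmooth[OF frame, of f]
    by (cases "f \<in> smooth_functions A") simp_all
  then have "value_at X p = (\<lambda>f. \<Sum>i\<in>UNIV. c i * E i f p)"
    by (simp add: value_at_def)
  then show ?thesis by (simp add: component_apply frame_coefficients)
qed

lemma metric_expansion:
  assumes "X \<in> vector_fields A" "Y \<in> vector_fields A"
  shows "metric_on_fields g X Y = (\<lambda>p. \<Sum>i\<in>UNIV. component X i p * component Y i p)"
proof
  fix p
  have "value_at X p = (\<lambda>f. \<Sum>i\<in>UNIV. component X i p * E i f p)"
    using field_expansion[OF assms(1)] by (simp add: value_at_def)
  then have "g p (value_at X p) (value_at Y p) = (\<Sum>i\<in>UNIV. component X i p * g p (value_at (E i) p) (value_at Y p))"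
    using metric_frame_sum[OF field_tangent[OF assms(2)]] by simp
  then show "metric_on_fields g X Y p = (\<Sum>i\<in>UNIV. component X i p * component Y i p)"
    using metric_sym[OF field_tangent[OF frame] field_tangent[OF assms(2)]]
    by (simp add: metric_on_fields_def component_apply)
qed

text \<open>Leibniz rule for variable coefficients: \<open>[Y\<^sub>l E\<^sub>l, E\<^sub>j] =
  Y\<^sub>l [E\<^sub>l, E\<^sub>j] - E\<^sub>j(Y\<^sub>l) E\<^sub>l\<close>, summed over
  \<open>l\<close>. The last term is what turns the Jacobi identity into differential
  equations.\<close>

lemma component_bracket_frame:
  assumes Y: "Y \<in> vector_fields A"
  shows "component (bracket Y (E j)) m p =
    (\<Sum>l\<in>UNIV. component Y l p * component (bracket (E l) (E j)) m p) - E j (component Y m) p"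
proof (rule component_unique[OF vector_fields_bracket[OF Y frame]])
  fix f assume f: "f \<in> smooth_functions A"
  note s = field_smooth[OF frame f]
  have "Y f = (\<lambda>q. \<Sum>l\<in>UNIV. component Y l q * E l f q)"
    using field_expansion[OF Y] by (simp add: fun_eq_iff)
  then have "E j (Y f) p = (\<Sum>l\<in>UNIV. E j (\<lambda>q. component Y l q * E l f q) p)"
    by (simp add: field_sum[OF frame smooth_mult[OF component_smooth[OF Y] s]])
  also have "\<dots> = (\<Sum>l\<in>UNIV. E j (component Y l) p * E l f p + component Y l p * E j (E l f) p)"
    by (simp only: field_mult[OF frame component_smooth[OF Y] s])
  finally have "bracket Y (E j) f p = (\<Sum>l\<in>UNIV. component Y l p * E l (E j f) p) -
      (\<Sum>l\<in>UNIV. E j (component Y l) p * E l f p + component Y l p * E j (E l f) p)"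
    by (simp add: bracket_def field_expansion[OF Y])
  also have "\<dots> = (\<Sum>l\<in>UNIV. component Y l p * bracket (E l) (E j) f p) - (\<Sum>m\<in>UNIV. E j (component Y m) p * E m f p)"
    by (simp add: bracket_def sum.distrib right_diff_distrib sum_subtractf)
  also have "(\<Sum>l\<in>UNIV. component Y l p * bracket (E l) (E j) f p) =
      (\<Sum>l\<in>UNIV. \<Sum>m\<in>UNIV. component Y l p * component (bracket (E l) (E j)) m p * E m f p)"
    by (simp add: field_expansion[OF vector_fields_bracket[OF frame frame]] sum_distrib_left mult.assoc)
  also have "\<dots> = (\<Sum>m\<in>UNIV. (\<Sum>l\<in>UNIV. component Y l p * component (bracket (E l) (E j)) m p) * E m f p)"
    by (subst sum.swap) (simp add: sum_distrib_right)
  finally show "bracket Y (E j) f p = (\<Sum>m\<in>UNIV.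
      ((\<Sum>l\<in>UNIV. component Y l p * component (bracket (E l) (E j)) m p) - E j (component Y m) p) * E m f p)"
    by (simp add: left_diff_distrib sum_subtractf)
qed

text \<open>With constant coefficients \<open>X\<close> differentiates nothing but the frame. The
  case of interest is \<open>Y = [E\<^sub>i, E\<^sub>j]\<close>, whose coefficients are structure
  constants.\<close>

lemma component_bracket_constant:
  assumes X: "X \<in> vector_fields A" and Y: "Y \<in> vector_fields A"
    and c: "\<And>f p. f \<in> smooth_functions A \<Longrightarrow> Y f p = (\<Sum>l\<in>UNIV. c l * E l f p)"
  shows "component (bracket X Y) m p = (\<Sum>l\<in>UNIV. c l * component (bracket X (E l)) m p)"
proof (rule component_unique[OF vector_fields_bracket[OF X Y]])
  fix f assume f: "f \<in> smooth_functions A"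
  note s = field_smooth[OF frame f]
  have "Y f = (\<lambda>q. \<Sum>l\<in>UNIV. c l * E l f q)" using c[OF f] by (simp add: fun_eq_iff)
  then have "X (Y f) p = (\<Sum>l\<in>UNIV. X (\<lambda>q. c l * E l f q) p)"
    by (simp add: field_sum[OF X smooth_mult[OF smooth_const s]])
  also have "\<dots> = (\<Sum>l\<in>UNIV. c l * X (E l f) p)" by (simp only: field_cmult[OF X s])
  finally have "bracket X Y f p = (\<Sum>l\<in>UNIV. c l * bracket X (E l) f p)"
    using c[OF field_smooth[OF X f]] by (simp add: bracket_def right_diff_distrib sum_subtractf)
  also have "\<dots> = (\<Sum>l\<in>UNIV. \<Sum>m\<in>UNIV. c l * component (bracket X (E l)) m p * E m f p)"
    by (simp add: field_expansion[OF vector_fields_bracket[OF X frame]] sum_distrib_left mult.assoc)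
  also have "\<dots> = (\<Sum>m\<in>UNIV. (\<Sum>l\<in>UNIV. c l * component (bracket X (E l)) m p) * E m f p)"
    by (subst sum.swap) (simp add: sum_distrib_right)
  finally show "bracket X Y f p = (\<Sum>m\<in>UNIV. (\<Sum>l\<in>UNIV. c l * component (bracket X (E l)) m p) * E m f p)" .
qed

lemma component_eqI:
  assumes "X \<in> vector_fields A" "Y \<in> vector_fields A" "Z \<in> vector_fields A"
    and "\<And>f. f \<in> smooth_functions A \<Longrightarrow> X f p = Y f p - Z f p"
  shows "component X m p = component Y m p - component Z m p"
proof (rule component_unique[OF assms(1)])
  show "X f p = (\<Sum>i\<in>UNIV. (component Y i p - component Z i p) * E i f p)" if "f \<in> smooth_functions A" for f
    using assms(4)[OF that] field_expansion[OF assms(2), of f p] field_expansion[OF assms(3), of f p]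
    by (simp add: left_diff_distrib sum_subtractf)
qed

text \<open>The inner products of frame fields are constant, so on the frame the Killing equation
  says that the matrix of the bracket with \<open>X\<close> is skew.\<close>

lemma killing_component_antisym:
  assumes "X \<in> killing_fields A g"
  shows "component (bracket X (E i)) j p = - component (bracket X (E j)) i p"
proof -
  have X: "X \<in> vector_fields A" using assms by (simp add: killing_fields_def)
  have "metric_on_fields g (E i) (E j) = (\<lambda>p. if i = j then 1 else 0)"
    by (simp add: metric_on_fields_def orthonormal)
  then have "X (metric_on_fields g (E i) (E j)) p = 0" using field_const[OF X] by simp
  moreover have "X (metric_on_fields g (E i) (E j)) p =
      metric_on_fields g (bracket X (E i)) (E j) p + metric_on_fields g (E i) (bracket X (E j)) p"
    using assms frame by (simp add: killing_fields_def)
  moreover have "metric_on_fields g (E i) (bracket X (E j)) p = component (bracket X (E j)) i p"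
    using metric_sym[OF field_tangent[OF frame] field_tangent[OF vector_fields_bracket[OF X frame]]]
    by (simp add: metric_on_fields_def component_apply)
  ultimately show ?thesis by (simp add: component_def)
qed

text \<open>A field commuting with the frame acts on other fields by differentiating their
  components. In components the metric is the standard inner product, so the Killing equation
  becomes the product rule. This is how right-invariant fields are seen to be Killing.\<close>

lemma killing_if_commutes:
  assumes X: "X \<in> vector_fields A" and comm: "\<And>i f p. f \<in> smooth_functions A \<Longrightarrow> bracket X (E i) f p = 0"
  shows "X \<in> killing_fields A g"
proof -
  have component: "component (bracket X Y) i p = X (component Y i) p" if Y: "Y \<in> vector_fields A" for Y i p
  proof (rule component_unique[OF vector_fields_bracket[OF X Y]])
    fix f assume f: "f \<in> smooth_functions A"
    note s = field_smooth[OF frame f]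
    have "Y f = (\<lambda>q. \<Sum>l\<in>UNIV. component Y l q * E l f q)"
      using field_expansion[OF Y] by (simp add: fun_eq_iff)
    then have "X (Y f) p = (\<Sum>l\<in>UNIV. X (\<lambda>q. component Y l q * E l f q) p)"
      by (simp add: field_sum[OF X smooth_mult[OF component_smooth[OF Y] s]])
    also have "\<dots> = (\<Sum>l\<in>UNIV. X (component Y l) p * E l f p + component Y l p * X (E l f) p)"
      by (simp only: field_mult[OF X component_smooth[OF Y] s])
    also have "\<dots> = (\<Sum>l\<in>UNIV. X (component Y l) p * E l f p) + Y (X f) p"
      using comm[OF f] by (simp add: sum.distrib field_expansion[OF Y] bracket_def)
    finally show "bracket X Y f p = (\<Sum>i\<in>UNIV. X (component Y i) p * E i f p)"
      by (simp add: bracket_def)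
  qed
  show ?thesis
    unfolding killing_fields_def
  proof (intro CollectI conjI X ballI ext)
    fix Y Z p assume Y: "Y \<in> vector_fields A" and Z: "Z \<in> vector_fields A"
    have "X (metric_on_fields g Y Z) p = (\<Sum>i\<in>UNIV. X (\<lambda>p. component Y i p * component Z i p) p)"
      by (simp add: metric_expansion[OF Y Z] field_sum[OF X smooth_mult[OF component_smooth[OF Y] component_smooth[OF Z]]])
    also have "\<dots> = (\<Sum>i\<in>UNIV. X (component Y i) p * component Z i p) + (\<Sum>i\<in>UNIV. component Y i p * X (component Z i) p)"
      by (simp only: field_mult[OF X component_smooth[OF Y] component_smooth[OF Z]] sum.distrib)
    finally show "X (metric_on_fields g Y Z) p =
        (metric_on_fields g (bracket X Y) Z + metric_on_fields g Y (bracket X Z)) p"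
      by (simp add: metric_expansion[OF vector_fields_bracket[OF X Y] Z]
          metric_expansion[OF Y vector_fields_bracket[OF X Z]] component[OF Y] component[OF Z])
  qed
qed

text \<open>A field commuting with the frame at \<open>p\<close> satisfies \<open>\<nabla>\<^sub>Y X = \<nabla>\<^sub>X Y\<close> at \<open>p\<close> for the frame fields
  \<open>Y\<close>, so its covariant derivative at \<open>p\<close> is determined by its value there.\<close>

lemma parallel_at_transfer:
  assumes D: "levi_civita A g D" and X: "X \<in> vector_fields A" and Y: "Y \<in> vector_fields A"
    and comm: "\<And>i. value_at (bracket X (E i)) p = 0" "\<And>i. value_at (bracket Y (E i)) p = 0"
    and val: "value_at X p = value_at Y p" and par: "parallel_at A D p X"
  shows "parallel_at A D p Y"
proof -
  have DVF: "D V W \<in> vector_fields A" if "V \<in> vector_fields A" "W \<in> vector_fields A" for V W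
    using D that unfolding levi_civita_def by blast
  have add: "D (V + W) Z = D V Z + D W Z" and scale: "D (fscale h V) Z = fscale h (D V Z)"
    if "V \<in> vector_fields A" "W \<in> vector_fields A" "Z \<in> vector_fields A" "h \<in> smooth_functions A" for V W Z h
    using D that unfolding levi_civita_def by blast+
  have torsion: "D V W - D W V = bracket V W" if "V \<in> vector_fields A" "W \<in> vector_fields A" for V W
    using D that unfolding levi_civita_def by blast
  have zero: "D 0 Z = 0" if Z: "Z \<in> vector_fields A" for Z
  proof -
    have "fscale (\<lambda>_. 0) Z = 0" "fscale (\<lambda>_. 0) (D Z Z) = 0" by (simp_all add: fscale_def fun_eq_iff)
    then show ?thesis using scale[OF Z Z Z smooth_const, of 0] by simp
  qed
  have sum: "D (\<Sum>i\<in>I. V i) Z = (\<Sum>i\<in>I. D (V i) Z)"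
    if "finite I" "\<And>i. V i \<in> vector_fields A" "Z \<in> vector_fields A" for I and V :: "'i \<Rightarrow> 'g vfield" and Z
    using that(1)
  proof induction
    case empty
    show ?case by (simp only: sum.empty zero[OF that(3)])
  next
    case (insert i I)
    have "sum V I \<in> vector_fields A" using that(2) by (rule vector_fields_sum)
    from add[OF that(2) this that(3) smooth_const]
    show ?case by (simp only: sum.insert[OF insert.hyps] insert.IH)
  qed
  \<comment> \<open>By function-linearity in the first argument and the global frame,
    \<open>D V Z\<close> at \<open>q\<close> depends on \<open>V\<close> only through its components
    at \<open>q\<close>.\<close>
  have expand: "D V Z f q = (\<Sum>i\<in>UNIV. component V i q * D (E i) Z f q)"
    if V: "V \<in> vector_fields A" and Z: "Z \<in> vector_fields A" for V Z f q
  proof -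
    have "D V Z = D (\<Sum>i\<in>UNIV. fscale (component V i) (E i)) Z"
      by (rule arg_cong[where f = "\<lambda>W. D W Z", OF field_expansion_fscale[OF V]])
    also have "\<dots> = (\<Sum>i\<in>UNIV. D (fscale (component V i) (E i)) Z)"
      by (rule sum[OF finite _ Z]) (rule vector_fields_fscale[OF frame component_smooth[OF V]])
    also have "\<dots> = (\<Sum>i\<in>UNIV. fscale (component V i) (D (E i) Z))"
      by (simp only: scale[OF frame frame Z component_smooth[OF V]])
    finally show ?thesis by (simp add: sum_field_apply fscale_def)
  qed
  have swap: "D (E i) V f p = D V (E i) f p"
    if V: "V \<in> vector_fields A" and 0: "value_at (bracket V (E i)) p = 0" for V i f
  proof -
    have "(D V (E i) - D (E i) V) f p = value_at (bracket V (E i)) p f"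
      by (simp only: torsion[OF V frame] value_at_apply)
    then show ?thesis using 0 by simp
  qed
  have "D (E i) Y f p = 0" for i f
  proof -
    have "D (E i) Y f p = D Y (E i) f p" by (rule swap[OF Y comm(2)])
    also have "\<dots> = D X (E i) f p"
      by (simp only: expand[OF Y frame] expand[OF X frame] component_apply val)
    also have "\<dots> = D (E i) X f p" by (rule swap[OF X comm(1), symmetric])
    also have "\<dots> = value_at (D (E i) X) p f" by (simp only: value_at_apply)
    also have "\<dots> = 0" using par frame by (simp add: parallel_at_def)
    finally show ?thesis .
  qed
  then show ?thesis
    unfolding parallel_at_def by (auto simp: fun_eq_iff value_at_apply expand[OF _ Y])
qed

end


section \<open>Invariant vector fields\<close>

context Lie_group
begin

lemma inv_mult_cancel [simp]: "inv x \<otimes> (x \<otimes> y) = y" "x \<otimes> (inv x \<otimes> y) = y"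
  by (simp_all add: m_assoc[symmetric])

lemma left_invariant_vector_field: "X \<in> left_invariant_fields G A \<Longrightarrow> X \<in> vector_fields A"
  by (simp add: left_invariant_fields_def)

lemma right_invariant_vector_field: "X \<in> right_invariant_fields G A \<Longrightarrow> X \<in> vector_fields A"
  by (simp add: right_invariant_fields_def)

lemma left_invariant_apply:
  assumes "X \<in> left_invariant_fields G A" "f \<in> smooth_functions A"
  shows "X f (x \<otimes> p) = X (\<lambda>q. f (x \<otimes> q)) p"
proof -
  have "value_at X (x \<otimes> p) f = pushforward A (\<lambda>q. x \<otimes> q) (value_at X p) f"
    using assms(1) by (simp add: left_invariant_fields_def)
  then show ?thesis using assms(2) by (simp add: value_at_apply pushforward_def comp_def)
qed

lemma right_invariant_apply:
  assumes "X \<in> right_invariant_fields G A" "f \<in> smooth_functions A"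
  shows "X f (p \<otimes> x) = X (\<lambda>q. f (q \<otimes> x)) p"
proof -
  have "value_at X (p \<otimes> x) f = pushforward A (\<lambda>q. q \<otimes> x) (value_at X p) f"
    using assms(1) by (simp add: right_invariant_fields_def)
  then show ?thesis using assms(2) by (simp add: value_at_apply pushforward_def comp_def)
qed

lemma left_invariant_at_one:
  "X \<in> left_invariant_fields G A \<Longrightarrow> f \<in> smooth_functions A \<Longrightarrow> X f p = X (\<lambda>q. f (p \<otimes> q)) \<one>"
  using left_invariant_apply[of X f p \<one>] by simp

lemma right_invariant_at_one:
  "X \<in> right_invariant_fields G A \<Longrightarrow> f \<in> smooth_functions A \<Longrightarrow> X f p = X (\<lambda>q. f (q \<otimes> p)) \<one>"
  using right_invariant_apply[of X f \<one> p] by simp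

lemma left_invariant_fieldsI:
  assumes X: "X \<in> vector_fields A"
    and "\<And>f x p. f \<in> smooth_functions A \<Longrightarrow> X f (x \<otimes> p) = X (\<lambda>q. f (x \<otimes> q)) p"
  shows "X \<in> left_invariant_fields G A"
  unfolding left_invariant_fields_def
proof (intro CollectI conjI X allI ext)
  show "value_at X (x \<otimes> p) f = pushforward A (\<lambda>q. x \<otimes> q) (value_at X p) f" for x p f
    using assms(2)[of f x p] tangent_nonsmooth[OF field_tangent[OF X]]
    by (cases "f \<in> smooth_functions A") (simp_all add: value_at_apply pushforward_def comp_def)
qed

lemma right_invariant_fieldsI:
  assumes X: "X \<in> vector_fields A"
    and "\<And>f x p. f \<in> smooth_functions A \<Longrightarrow> X f (p \<otimes> x) = X (\<lambda>q. f (q \<otimes> x)) p"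
  shows "X \<in> right_invariant_fields G A"
  unfolding right_invariant_fields_def
proof (intro CollectI conjI X allI ext)
  show "value_at X (p \<otimes> x) f = pushforward A (\<lambda>q. q \<otimes> x) (value_at X p) f" for x p f
    using assms(2)[of f p x] tangent_nonsmooth[OF field_tangent[OF X]]
    by (cases "f \<in> smooth_functions A") (simp_all add: value_at_apply pushforward_def comp_def)
qed

lemma left_invariant_bracket:
  assumes X: "X \<in> left_invariant_fields G A" and Y: "Y \<in> left_invariant_fields G A"
  shows "bracket X Y \<in> left_invariant_fields G A"
proof (rule left_invariant_fieldsI)
  note XY = left_invariant_vector_field[OF X] left_invariant_vector_field[OF Y]
  show "bracket X Y \<in> vector_fields A" by (rule vector_fields_bracket[OF XY])
  fix f x p assume f: "f \<in> smooth_functions A"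
  have "(\<lambda>q. X f (x \<otimes> q)) = X (\<lambda>q. f (x \<otimes> q))" "(\<lambda>q. Y f (x \<otimes> q)) = Y (\<lambda>q. f (x \<otimes> q))"
    using left_invariant_apply[OF X f] left_invariant_apply[OF Y f] by auto
  then show "bracket X Y f (x \<otimes> p) = bracket X Y (\<lambda>q. f (x \<otimes> q)) p"
    by (simp only: bracket_def left_invariant_apply[OF X field_smooth[OF XY(2) f]]
        left_invariant_apply[OF Y field_smooth[OF XY(1) f]])
qed

text \<open>Building right-invariant fields by inversion makes their smoothness obvious; for the formula
  \<open>R f p = v (\<lambda>q. f (q \<otimes> p))\<close> it would require differentiating in two variables.\<close>

lemma right_invariant_inversion:
  assumes L: "L \<in> left_invariant_fields G A"
  shows "(\<lambda>f p. L (\<lambda>q. f (inv q)) (inv p)) \<in> right_invariant_fields G A"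
proof (rule right_invariant_fieldsI)
  let ?R = "\<lambda>f p. L (\<lambda>q. f (inv q)) (inv p)"
  have LV: "L \<in> vector_fields A" using L by (rule left_invariant_vector_field)
  show "?R \<in> vector_fields A"
  proof (rule vector_fieldsI)
    fix p
    show "value_at ?R p \<in> tangent_space A p"
    proof (rule tangent_spaceI)
      fix f assume f: "f \<notin> smooth_functions A"
      \<comment> \<open>Inversion is an involution, so smoothness of \<open>f \<circ> inv\<close>
        would make \<open>f\<close> smooth.\<close>
      have "(\<lambda>q. f (inv q)) \<notin> smooth_functions A"
        using smooth_inversion[of "\<lambda>q. f (inv q)"] f by auto
      then show "value_at ?R p f = 0" by (simp add: value_at_apply field_nonsmooth[OF LV])
    next
      fix f h and r s :: real
      assume fh: "f \<in> smooth_functions A" "h \<in> smooth_functions A"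
      show "value_at ?R p (\<lambda>x. r * f x + s * h x) = r * value_at ?R p f + s * value_at ?R p h"
        by (simp only: value_at_apply field_lincomb[OF LV smooth_inversion[OF fh(1)] smooth_inversion[OF fh(2)]])
      show "value_at ?R p (\<lambda>x. f x * h x) = value_at ?R p f * h p + f p * value_at ?R p h"
        by (simp add: value_at_apply field_mult[OF LV smooth_inversion[OF fh(1)] smooth_inversion[OF fh(2)]])
    qed
  next
    show "?R f \<in> smooth_functions A" if "f \<in> smooth_functions A" for f
      by (rule smooth_inversion[OF field_smooth[OF LV smooth_inversion[OF that]]])
  qed
  fix f x p assume f: "f \<in> smooth_functions A"
  \<comment> \<open>Inversion carries the right translation by \<open>x\<close> to the left
    translation by \<open>inv x\<close>.\<close>
  have "L (\<lambda>q. f (inv q)) (inv x \<otimes> inv p) = L (\<lambda>q. f (inv (inv x \<otimes> q))) (inv p)"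
    by (rule left_invariant_apply[OF L smooth_inversion[OF f]])
  then show "?R f (p \<otimes> x) = ?R (\<lambda>q. f (q \<otimes> x)) p"
    by (simp add: inv_mult_group)
qed

text \<open>Both sides are mixed partial derivatives of \<open>f (p \<otimes> q)\<close> at \<open>(\<one>, \<one>)\<close>.\<close>

lemma bracket_right_left_at_one:
  assumes R: "R \<in> right_invariant_fields G A" and L: "L \<in> left_invariant_fields G A"
    and S: "finite S" "card S \<le> DIM('m)" "tangent_space A \<one> \<subseteq> tangent_span S"
    and f: "f \<in> smooth_functions A"
  shows "R (L f) \<one> = L (R f) \<one>"
proof -
  note RV = right_invariant_vector_field[OF R] and LV = left_invariant_vector_field[OF L]
  obtain U \<phi> where U: "(U, \<phi>) \<in> A" "\<one> \<in> U" by (rule chart_cover)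
  obtain w where w: "value_at R \<one> = chart_derivation A U \<phi> \<one> w"
    by (rule tangent_space_chart_derivation[OF atlas U S field_tangent[OF RV]])
  obtain z where z: "value_at L \<one> = chart_derivation A U \<phi> \<one> z"
    by (rule tangent_space_chart_derivation[OF atlas U S field_tangent[OF LV]])
  let ?h = "\<lambda>z. f (fst z \<otimes> snd z)"
  have Lf: "L f = (\<lambda>p. chart_derivation A U \<phi> \<one> z (\<lambda>q. ?h (p, q)))"
    using left_invariant_at_one[OF L f] by (simp add: fun_eq_iff z[symmetric] value_at_apply)
  have Rf: "R f = (\<lambda>q. chart_derivation A U \<phi> \<one> w (\<lambda>p. ?h (p, q)))"
    using right_invariant_at_one[OF R f] by (simp add: fun_eq_iff w[symmetric] value_at_apply)
  have "chart_derivation A U \<phi> \<one> w (L f) = chart_derivation A U \<phi> \<one> z (R f)"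
    unfolding Lf Rf
    by (rule chart_derivations_commute[OF atlas atlas smooth_group_mult[OF f] U U])
       (use field_smooth[OF LV f] field_smooth[OF RV f] in \<open>simp_all only: Lf Rf\<close>)
  then show ?thesis by (simp only: w[symmetric] z[symmetric] value_at_apply)
qed

end

section \<open>Invariant extensions of tangent vectors; left- and right-invariant fields
  commute\<close>

locale left_invariant_frame = Lie_group G A + orthonormal_frame A g E
  for G :: "'g::{t2_space, second_countable_topology} monoid" (structure)
    and A :: "('g, 'm::euclidean_space) chart set"
    and g and E :: "'i::finite \<Rightarrow> 'g vfield" +
  assumes frame_left_invariant: "\<And>i. E i \<in> left_invariant_fields G A"
    and card_frame: "CARD('i) \<le> DIM('m)"
begin

text \<open>Constant coefficients in the frame replace the translation of \<open>v\<close> to all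
  points, so smoothness is inherited from the frame.\<close>

lemma left_invariant_extension:
  assumes "v \<in> tangent_space A \<one>"
  obtains L where "L \<in> left_invariant_fields G A" "value_at L \<one> = v"
proof -
  obtain c where c: "v = (\<lambda>f. \<Sum>i\<in>UNIV. c i * E i f \<one>)" using spanning[OF assms] by blast
  let ?L = "\<lambda>f p. \<Sum>i\<in>UNIV. c i * E i f p"
  have "?L = (\<Sum>i\<in>UNIV. fscale (\<lambda>_. c i) (E i))"
    by (intro ext) (simp add: sum_field_apply fscale_def)
  then have "?L \<in> vector_fields A"
    using vector_fields_sum[of UNIV "\<lambda>i. fscale (\<lambda>_. c i) (E i)"]
      vector_fields_fscale[OF frame smooth_const] by simp
  then have "?L \<in> left_invariant_fields G A"
    by (rule left_invariant_fieldsI) (simp only: left_invariant_apply[OF frame_left_invariant])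
  moreover have "value_at ?L \<one> = v" by (simp add: value_at_def c)
  ultimately show thesis by (rule that)
qed

text \<open>A field built by inversion has at \<open>\<one>\<close> the image under inversion of the
  left-invariant value. Starting from the image of \<open>v\<close>, the second inversion returns
  \<open>v\<close>.\<close>

lemma right_invariant_extension:
  assumes v: "v \<in> tangent_space A \<one>"
  obtains R where "R \<in> right_invariant_fields G A" "value_at R \<one> = v"
proof -
  have "pushforward A (\<lambda>q. inv q) v \<in> tangent_space A \<one>"
    using tangent_pushforward[OF smooth_inversion v] by simp
  then obtain L where L: "L \<in> left_invariant_fields G A" "value_at L \<one> = pushforward A (\<lambda>q. inv q) v"
    by (rule left_invariant_extension)
  let ?R = "\<lambda>f p. L (\<lambda>q. f (inv q)) (inv p)"
  have R: "?R \<in> right_invariant_fields G A" by (rule right_invariant_inversion[OF L(1)])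
  have "value_at ?R \<one> f = v f" for f
  proof (cases "f \<in> smooth_functions A")
    case True
    have "value_at ?R \<one> f = value_at L \<one> (\<lambda>q. f (inv q))" by (simp add: value_at_apply)
    also have "\<dots> = v f" using smooth_inversion[OF True] by (simp add: L(2) pushforward_def comp_def)
    finally show ?thesis .
  next
    case False
    then show ?thesis
      using tangent_nonsmooth[OF field_tangent[OF right_invariant_vector_field[OF R]] False]
        tangent_nonsmooth[OF v False] by (simp only:)
  qed
  then have "value_at ?R \<one> = v" by (rule ext)
  with R show thesis by (rule that)
qed

lemma tangent_space_one_span:
  "tangent_space A \<one> \<subseteq> tangent_span (range (\<lambda>i. value_at (E i) \<one>))"
proof
  fix v assume "v \<in> tangent_space A \<one>"
  then obtain c where c: "v = (\<lambda>f. \<Sum>i\<in>UNIV. c i * E i f \<one>)" using spanning by blast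
  have "v = (\<Sum>i\<in>UNIV. tscale (c i) (value_at (E i) \<one>))"
  proof
    have "(\<Sum>i\<in>I. tscale (c i) (value_at (E i) \<one>)) f = (\<Sum>i\<in>I. c i * E i f \<one>)" for I f
      by (induction I rule: infinite_finite_induct) (auto simp: tscale_def value_at_apply)
    then show "v f = (\<Sum>i\<in>UNIV. tscale (c i) (value_at (E i) \<one>)) f" for f by (simp add: c)
  qed
  also have "\<dots> \<in> tangent_span (range (\<lambda>i. value_at (E i) \<one>))"
    by (intro tangent.span_sum tangent.span_scale tangent.span_base) auto
  finally show "v \<in> tangent_span (range (\<lambda>i. value_at (E i) \<one>))" .
qed

text \<open>The frame at \<open>\<one>\<close> serves as the spanning set, and
  \<open>card_frame\<close> bounds its size.\<close>

lemma right_left_commute_at_one: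
  assumes "R \<in> right_invariant_fields G A" "L \<in> left_invariant_fields G A" "f \<in> smooth_functions A"
  shows "R (L f) \<one> = L (R f) \<one>"
  by (rule bracket_right_left_at_one[OF assms(1,2) _ _ tangent_space_one_span assms(3)])
     (auto intro: order_trans[OF card_image_le card_frame])

text \<open>Conjugation by \<open>p\<close> reduces the claim at \<open>p\<close> to the one at \<open>\<one>\<close>.\<close>

lemma bracket_right_left:
  assumes R: "R \<in> right_invariant_fields G A" and L: "L \<in> left_invariant_fields G A"
    and f: "f \<in> smooth_functions A"
  shows "bracket R L f p = 0"
proof -
  note RV = right_invariant_vector_field[OF R] and LV = left_invariant_vector_field[OF L]
  \<comment> \<open>Since \<open>q \<otimes> p = p \<otimes> ?c q\<close>, the right translation by
    \<open>p\<close> becomes a left translation, past which \<open>L\<close> moves by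
    invariance.\<close>
  let ?c = "\<lambda>q. inv p \<otimes> q \<otimes> p"
  have conj: "(\<lambda>q. h (?c q)) \<in> smooth_functions A" if "h \<in> smooth_functions A" for h
    using smooth_left_translation[OF smooth_right_translation[OF that, of p], of "inv p"] by simp
  have "pushforward A ?c (value_at R \<one>) \<in> tangent_space A (?c \<one>)"
    by (rule tangent_pushforward[OF conj field_tangent[OF RV]])
  then have "pushforward A ?c (value_at R \<one>) \<in> tangent_space A \<one>" by simp
  then obtain R' where R': "R' \<in> right_invariant_fields G A"
    and val: "value_at R' \<one> = pushforward A ?c (value_at R \<one>)"
    by (rule right_invariant_extension)
  have R'1: "R' h \<one> = R (\<lambda>q. h (?c q)) \<one>" if "h \<in> smooth_functions A" for h
    using fun_cong[OF val, of h] that by (simp add: value_at_apply pushforward_def comp_def)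
  let ?f = "\<lambda>q. f (p \<otimes> q)"
  have fp: "?f \<in> smooth_functions A" by (rule smooth_left_translation[OF f])
  have shift: "p \<otimes> (?c q \<otimes> r) = q \<otimes> (p \<otimes> r)" for q r by (simp add: m_assoc)
  have "R (L f) p = R (\<lambda>q. L f (q \<otimes> p)) \<one>"
    by (rule right_invariant_at_one[OF R field_smooth[OF LV f]])
  also have "(\<lambda>q. L f (q \<otimes> p)) = (\<lambda>q. L ?f (?c q))"
    using left_invariant_apply[OF L f, of p "?c q" for q] by (simp add: m_assoc)
  also have "R (\<lambda>q. L ?f (?c q)) \<one> = R' (L ?f) \<one>"
    by (rule R'1[OF field_smooth[OF LV fp], symmetric])
  also have "\<dots> = L (R' ?f) \<one>" by (rule right_left_commute_at_one[OF R' L fp])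
  \<comment> \<open>Left translation by \<open>p\<close> carries \<open>R'\<close> to
    \<open>R\<close>; the conjugation was chosen to match the two right-invariant fields.\<close>
  also have "R' ?f = (\<lambda>r. R f (p \<otimes> r))"
  proof
    fix r
    have "R' ?f r = R' (\<lambda>q. ?f (q \<otimes> r)) \<one>" by (rule right_invariant_at_one[OF R' fp])
    also have "\<dots> = R (\<lambda>q. ?f (?c q \<otimes> r)) \<one>"
      by (rule R'1[OF smooth_right_translation[OF fp]])
    also have "\<dots> = R (\<lambda>q. f (q \<otimes> (p \<otimes> r))) \<one>" by (simp only: shift)
    also have "\<dots> = R f (p \<otimes> r)" by (rule right_invariant_at_one[OF R f, symmetric])
    finally show "R' ?f r = R f (p \<otimes> r)" .
  qed
  also have "L (\<lambda>r. R f (p \<otimes> r)) \<one> = L (R f) p"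
    by (rule left_invariant_at_one[OF L field_smooth[OF RV f], symmetric])
  finally show ?thesis by (simp add: bracket_def)
qed

lemma right_invariant_killing:
  assumes "R \<in> right_invariant_fields G A"
  shows "R \<in> killing_fields A g"
  by (rule killing_if_commutes[OF right_invariant_vector_field[OF assms]])
     (rule bracket_right_left[OF assms frame_left_invariant])

lemma value_bracket_right_left:
  assumes "R \<in> right_invariant_fields G A"
  shows "value_at (bracket R (E i)) p = 0"
proof
  have "bracket R (E i) \<in> vector_fields A"
    by (rule vector_fields_bracket[OF right_invariant_vector_field[OF assms] frame])
  then show "value_at (bracket R (E i)) p f = 0 f" for f
    using bracket_right_left[OF assms frame_left_invariant, of f i p] tangent_nonsmooth[OF field_tangent, of "bracket R (E i)" f p]
    by (cases "f \<in> smooth_functions A") (simp_all add: value_at_apply)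
qed

lemma index_space_eq_subindex_space:
  assumes D: "levi_civita A g D"
    and comm: "\<And>X i p. X \<in> killing_fields A g \<Longrightarrow> value_at (bracket X (E i)) p = 0"
  shows "index_space G A g D = subindex_space G A D"
proof (intro equalityI subsetI)
  fix v assume "v \<in> index_space G A g D"
  then obtain X where X: "X \<in> killing_fields A g" "parallel_at A D \<one> X" "v = value_at X \<one>"
    by (auto simp: index_space_def)
  have XV: "X \<in> vector_fields A" using X(1) by (simp add: killing_fields_def)
  obtain R where R: "R \<in> right_invariant_fields G A" "value_at R \<one> = value_at X \<one>"
    by (rule right_invariant_extension[OF field_tangent[OF XV]])
  have "parallel_at A D \<one> R"
    by (rule parallel_at_transfer[OF D XV right_invariant_vector_field[OF R(1)] comm[OF X(1)]
        value_bracket_right_left[OF R(1)] R(2)[symmetric] X(2)])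
  then show "v \<in> subindex_space G A D"
    unfolding subindex_space_def using R X(3) by (intro CollectI exI[of _ R]) simp
next
  fix v assume "v \<in> subindex_space G A D"
  then show "v \<in> index_space G A g D"
    using right_invariant_killing by (auto simp: index_space_def subindex_space_def)
qed

end


section \<open>Killing fields of groups with a generic triple\<close>

text \<open>Let \<open>q\<close> be the square root in the Ricci entries. \<open>ricci22\<close> and
  \<open>ricci33\<close> differ by a multiple of \<open>(b + c) * q\<close>, so \<open>b + c\<close>
  is nonzero and \<open>a\<close>, \<open>b - c\<close> do not both vanish, which settles
  \<open>w\<close>. The differences of \<open>ricci11\<close> from the other two are multiples of
  \<open>b + c - q\<close> and \<open>b + c + q\<close>, whose product is
  \<open>4 * (b * c - a\<^sup>2)\<close>; the determinant of the equations for \<open>u, v\<close>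
  is this number up to a nonzero factor.\<close>

lemma generic_coefficients_zero:
  fixes u v w :: real
  assumes gen: "generic a b c"
    and w1: "a * (b + c) * w = 0" and w2: "(b - c) * (b + c) * w = 0"
    and uv1: "(b + c) * (b * v - a * u) = 0" and uv2: "(b + c) * (a * v - c * u) = 0"
  shows "u = 0" "v = 0" "w = 0"
proof -
  let ?q = "sqrt (4 * a\<^sup>2 + (b - c)\<^sup>2)"
  have s: "b + c \<noteq> 0" and q: "?q \<noteq> 0"
    using gen by (auto simp: generic_def ricci22_def ricci33_def)
  have "a \<noteq> 0 \<or> b \<noteq> c" using q by auto
  then show "w = 0" using w1 w2 s by auto
  have "b + c \<noteq> ?q"
  proof
    assume "b + c = ?q"
    then have "?q = b + c" by simp
    then have "ricci11 a b c = ricci22 a b c"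
      by (simp only: ricci11_def ricci22_def) (simp add: power2_eq_square)
    then show False using gen by (simp add: generic_def)
  qed
  moreover have "b + c \<noteq> - ?q"
  proof
    assume "b + c = - ?q"
    then have "?q = - (b + c)" by simp
    then have "ricci11 a b c = ricci33 a b c"
      by (simp only: ricci11_def ricci33_def) (simp add: power2_eq_square algebra_simps)
    then show False using gen by (simp add: generic_def)
  qed
  ultimately have "(b + c)\<^sup>2 \<noteq> ?q\<^sup>2" unfolding power2_eq_iff by blast
  moreover have "?q\<^sup>2 = 4 * a\<^sup>2 + (b - c)\<^sup>2" by (rule real_sqrt_pow2) simp
  moreover have "(b + c)\<^sup>2 - (4 * a\<^sup>2 + (b - c)\<^sup>2) = - 4 * (a\<^sup>2 - b * c)"
    by (simp add: power2_eq_square algebra_simps)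
  ultimately have d: "a\<^sup>2 - b * c \<noteq> 0" by auto
  have e: "b * v = a * u" "a * v = c * u" using uv1 uv2 s by auto
  have "(a\<^sup>2 - b * c) * u = a * (a * u) - b * (c * u)" by (simp add: power2_eq_square algebra_simps)
  also have "\<dots> = 0" by (simp add: e[symmetric])
  finally show "u = 0" using d by simp
  have "(a\<^sup>2 - b * c) * v = a * (a * v) - c * (b * v)" by (simp add: power2_eq_square algebra_simps)
  also have "\<dots> = 0" by (simp add: e)
  finally show "v = 0" using d by simp
qed

locale triple_frame = left_invariant_frame G A g E
  for G :: "'g::{t2_space, second_countable_topology} monoid" (structure)
    and A :: "('g, 'm::euclidean_space) chart set"
    and g and E :: "3 \<Rightarrow> 'g vfield" +
  fixes a b c :: real
  assumes bracket12: "\<And>f p. bracket (E 1) (E 2) f p = a * E 2 f p + b * E 3 f p"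
    and bracket13: "\<And>f p. bracket (E 1) (E 3) f p = c * E 2 f p + a * E 3 f p"
    and bracket23: "\<And>f p. bracket (E 2) (E 3) f p = 0"
begin

definition structure_constant :: "3 \<Rightarrow> 3 \<Rightarrow> 3 \<Rightarrow> real" where
  "structure_constant i j k =
     (if i = 1 \<and> j = 2 then (if k = 2 then a else if k = 3 then b else 0)
      else if i = 2 \<and> j = 1 then (if k = 2 then - a else if k = 3 then - b else 0)
      else if i = 1 \<and> j = 3 then (if k = 2 then c else if k = 3 then a else 0)
      else if i = 3 \<and> j = 1 then (if k = 2 then - c else if k = 3 then - a else 0)
      else 0)"

lemma bracket_structure:
  "bracket (E i) (E j) f p = (\<Sum>k\<in>UNIV. structure_constant i j k * E k f p)"
proof -
  have "bracket (E i) (E j) f p = - bracket (E j) (E i) f p" for i j by (simp add: bracket_def)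
  note anti = this[of 2 1] this[of 3 1] this[of 3 2]
  have "bracket (E i) (E i) f p = 0" for i by (simp add: bracket_def)
  with exhaust_3[of i] exhaust_3[of j] show ?thesis
    by (auto simp: sum_3 structure_constant_def bracket12 bracket13 bracket23 anti)
qed

lemma component_bracket_frame_frame: "component (bracket (E i) (E j)) k p = structure_constant i j k"
  by (rule component_unique[OF vector_fields_bracket[OF frame frame] bracket_structure])

text \<open>Component \<open>m\<close> of the Jacobi identity for
  \<open>X, E\<^sub>i, E\<^sub>j\<close>. On the left the coefficients are constants; on the right
  they are the functions \<open>\<beta>\<close>, whence the derivatives along
  \<open>E\<^sub>i\<close> and \<open>E\<^sub>j\<close>.\<close>

lemma killing_structure:
  assumes X: "X \<in> vector_fields A"
  defines "\<beta> \<equiv> \<lambda>i m. component (bracket X (E i)) m"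
  shows "(\<Sum>l\<in>UNIV. structure_constant i j l * \<beta> l m p) =
    (\<Sum>l\<in>UNIV. \<beta> i l p * structure_constant l j m) - E j (\<beta> i m) p -
    ((\<Sum>l\<in>UNIV. \<beta> j l p * structure_constant l i m) - E i (\<beta> j m) p)"
proof -
  note XE = vector_fields_bracket[OF X frame]
  note EE = vector_fields_bracket[OF frame frame]
  have "component (bracket X (bracket (E i) (E j))) m p = (\<Sum>l\<in>UNIV. structure_constant i j l * \<beta> l m p)"
    unfolding \<beta>_def by (rule component_bracket_constant[OF X EE bracket_structure])
  moreover have "component (bracket X (bracket (E i) (E j))) m p =
      component (bracket (bracket X (E i)) (E j)) m p - component (bracket (bracket X (E j)) (E i)) m p"
    by (rule component_eqI[OF vector_fields_bracket[OF X EE] vector_fields_bracket[OF XE frame]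
          vector_fields_bracket[OF XE frame] jacobi_bracket[OF X frame frame]])
  ultimately show ?thesis
    by (simp only: component_bracket_frame[OF XE] component_bracket_frame_frame \<beta>_def)
qed

text \<open>The integrability conditions \<open>c12\<close>, \<open>c13\<close>, \<open>c23u\<close>, \<open>c23v\<close> below express that the Killing field
  preserves the Ricci tensor.\<close>

lemma killing_components_zero:
  assumes gen: "generic a b c" and X: "X \<in> killing_fields A g"
  shows "component (bracket X (E i)) j p = 0"
proof -
  have XV: "X \<in> vector_fields A" using X by (simp add: killing_fields_def)
  define \<beta> where "\<beta> = (\<lambda>i m. component (bracket X (E i)) m)"
  define u v w where "u = \<beta> 1 2" and "v = \<beta> 1 3" and "w = \<beta> 2 3"
  have smooth: "\<beta> i m \<in> smooth_functions A" for i m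
    unfolding \<beta>_def by (rule component_smooth[OF vector_fields_bracket[OF XV frame]])
  then have us: "u \<in> smooth_functions A" and vs: "v \<in> smooth_functions A" and ws: "w \<in> smooth_functions A"
    by (simp_all add: u_def v_def w_def)
  have skew: "\<beta> i m p = - \<beta> m i p" for i m p
    unfolding \<beta>_def by (rule killing_component_antisym[OF X])
  have diag: "\<beta> i i = (\<lambda>p. 0)" for i using skew[of i i] by auto
  have low: "\<beta> 2 1 = (\<lambda>p. - u p)" "\<beta> 3 1 = (\<lambda>p. - v p)" "\<beta> 3 2 = (\<lambda>p. - w p)"
    using skew[of 2 1] skew[of 3 1] skew[of 3 2] by (auto simp: u_def v_def w_def)
  note entries = diag low u_def[symmetric] v_def[symmetric] w_def[symmetric]
  have "component (bracket X (E i)) m = \<beta> i m" for i m by (simp add: \<beta>_def)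
  note K = killing_structure[OF XV, unfolded this]
  note der = field_const[OF frame] field_uminus[OF frame us] field_uminus[OF frame vs] field_uminus[OF frame ws]
  note ev = sum_3 structure_constant_def entries der
  \<comment> \<open>The digits in these names are \<open>i\<close>, \<open>j\<close> and
    \<open>m\<close> of \<open>killing_structure\<close>.\<close>
  have K121: "E 1 u p = a * u p + b * v p" for p using K[of 1 2 1 p] by (simp add: ev)
  have K122: "E 2 u p = (b + c) * w p" for p using K[of 1 2 2 p] by (simp add: ev algebra_simps)
  have K123: "E 2 v p = E 1 w p" for p using K[of 1 2 3 p] by (simp add: ev)
  have K131: "E 1 v p = c * u p + a * v p" for p using K[of 1 3 1 p] by (simp add: ev)
  have K132: "E 3 u p = - E 1 w p" for p using K[of 1 3 2 p] by (simp add: ev)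
  have K133: "E 3 v p = - ((b + c) * w p)" for p using K[of 1 3 3 p] by (simp add: ev algebra_simps)
  have K231: "E 3 u p = E 2 v p" for p using K[of 2 3 1 p] by (simp add: ev)
  have K232: "E 2 w p = a * v p - c * u p" for p using K[of 2 3 2 p] by (simp add: ev algebra_simps)
  have K233: "E 3 w p = b * v p - a * u p" for p using K[of 2 3 3 p] by (simp add: ev algebra_simps)
  \<comment> \<open>The three equations close up to
    \<open>E 2 v = E 1 w = - E 3 u = - E 2 v\<close>, so all of these derivatives vanish.\<close>
  have zero: "E 3 u p = 0" "E 2 v p = 0" "E 1 w p = 0" for p
    using K123[of p] K132[of p] K231[of p] by simp_all
  have E3u: "E 3 u = (\<lambda>p. 0)" and E2v: "E 2 v = (\<lambda>p. 0)" and E2u: "E 2 u = (\<lambda>p. (b + c) * w p)"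
    and E3v: "E 3 v = (\<lambda>p. - ((b + c) * w p))"
    using zero K122 K133 by auto
  have E1u: "E 1 u = (\<lambda>p. a * u p + b * v p)" using K121 by auto
  have sws: "(\<lambda>p. (b + c) * w p) \<in> smooth_functions A" by (rule smooth_mult[OF smooth_const ws])
  have wE: "E i (\<lambda>p. (b + c) * w p) p = (b + c) * E i w p"
    "E i (\<lambda>p. - ((b + c) * w p)) p = - ((b + c) * E i w p)" for i p
    by (simp_all add: field_cmult[OF frame ws] field_uminus[OF frame sws])
  \<comment> \<open>Applied to \<open>u\<close>, the bracket relation reduces to
    \<open>- a (b + c) w = a (b + c) w\<close>.\<close>
  have c12: "a * (b + c) * w p = 0" for p
  proof -
    have "E 1 (E 2 u) p - E 2 (E 1 u) p = a * E 2 u p + b * E 3 u p"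
      using bracket12[of u p] by (simp add: bracket_def)
    moreover have "E 1 (E 2 u) p = 0" unfolding E2u wE by (simp add: zero)
    moreover have "E 2 (E 1 u) p = a * E 2 u p + b * E 2 v p"
      unfolding E1u by (rule fun_cong[OF field_lincomb[OF frame us vs]])
    ultimately show ?thesis by (simp add: zero K122)
  qed
  \<comment> \<open>The term \<open>- b E 3 v\<close> contributes \<open>b (b + c) w\<close>, to be
    compared with \<open>c E 2 u = c (b + c) w\<close>.\<close>
  have c13: "(b - c) * (b + c) * w p = 0" for p
  proof -
    have "E 1 (E 3 u) p - E 3 (E 1 u) p = c * E 2 u p + a * E 3 u p"
      using bracket13[of u p] by (simp add: bracket_def)
    moreover have "E 1 (E 3 u) p = 0" unfolding E3u by (simp add: field_const[OF frame])
    moreover have "E 3 (E 1 u) p = a * E 3 u p + b * E 3 v p"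
      unfolding E1u by (rule fun_cong[OF field_lincomb[OF frame us vs]])
    ultimately show ?thesis by (simp add: zero K122 K133 algebra_simps)
  qed
  \<comment> \<open>With \<open>E 3 u = 0\<close>, only the derivative of \<open>E 2 u\<close> along
    \<open>E 3\<close> survives, hence that of \<open>w\<close>, which \<open>K233\<close> expresses
    by \<open>u\<close> and \<open>v\<close>.\<close>
  have c23u: "(b + c) * (b * v p - a * u p) = 0" for p
  proof -
    have "E 2 (E 3 u) p - E 3 (E 2 u) p = 0" using bracket23[of u p] by (simp add: bracket_def)
    moreover have "E 2 (E 3 u) p = 0" unfolding E3u by (simp add: field_const[OF frame])
    moreover have "E 3 (E 2 u) p = (b + c) * E 3 w p" unfolding E2u wE ..
    ultimately show ?thesis by (simp add: K233)
  qed
  have c23v: "(b + c) * (a * v p - c * u p) = 0" for p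
  proof -
    have "E 2 (E 3 v) p - E 3 (E 2 v) p = 0" using bracket23[of v p] by (simp add: bracket_def)
    moreover have "E 3 (E 2 v) p = 0" unfolding E2v by (simp add: field_const[OF frame])
    moreover have "E 2 (E 3 v) p = - ((b + c) * E 2 w p)" unfolding E3v wE ..
    ultimately show ?thesis by (simp add: K232)
  qed
  have "u p = 0" "v p = 0" "w p = 0" for p
    using generic_coefficients_zero[OF gen c12 c13 c23u c23v] by auto
  then have "\<beta> i j p = 0"
    using exhaust_3[of i] exhaust_3[of j] by (auto simp: entries)
  then show ?thesis by (simp add: \<beta>_def)
qed

lemma killing_commutes_frame:
  assumes "generic a b c" "X \<in> killing_fields A g"
  shows "value_at (bracket X (E i)) p = 0"
proof
  have "bracket X (E i) \<in> vector_fields A"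
    using assms(2) frame by (intro vector_fields_bracket) (simp_all add: killing_fields_def)
  then show "value_at (bracket X (E i)) p f = 0 f" for f
    by (simp add: value_at_apply field_expansion[of "bracket X (E i)"] killing_components_zero[OF assms])
qed

end

section \<open>Global frames from a triple at the identity\<close>

context Lie_group
begin

text \<open>Left translations are isometries and carry \<open>E i\<close> at \<open>\<one>\<close>
  to \<open>E i\<close> at \<open>p\<close>, so orthonormality and spanning spread from the identity
  to all points.\<close>

lemma left_invariant_frameI:
  fixes E :: "'i::finite \<Rightarrow> 'g vfield"
  assumes g: "left_invariant_metric G A g" and E: "\<And>i. E i \<in> left_invariant_fields G A"
    and ortho: "\<And>i j. g \<one> (value_at (E i) \<one>) (value_at (E j) \<one>) = (if i = j then 1 else 0)"
    and span: "tangent_space A \<one> \<subseteq> tangent_span (range (\<lambda>i. value_at (E i) \<one>))"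
    and card: "CARD('i) \<le> DIM('m)"
  shows "left_invariant_frame G A g E"
proof -
  note EV = left_invariant_vector_field[OF E]
  have shift: "value_at (E i) p = pushforward A (\<lambda>q. p \<otimes> q) (value_at (E i) \<one>)" for i p
    using E[of i] by (auto simp: left_invariant_fields_def dest: spec2[of _ p \<one>])
  have one: "\<exists>c. \<forall>f. v f = (\<Sum>i\<in>UNIV. c i * E i f \<one>)" if "v \<in> tangent_space A \<one>" for v
  proof -
    have "tangent_span (range (\<lambda>i. value_at (E i) \<one>)) \<subseteq> {v. \<exists>c. \<forall>f. v f = (\<Sum>i\<in>UNIV. c i * E i f \<one>)}"
    proof (rule tangent.span_minimal)
      show "range (\<lambda>i. value_at (E i) \<one>) \<subseteq> {v. \<exists>c. \<forall>f. v f = (\<Sum>i\<in>UNIV. c i * E i f \<one>)}"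
      proof clarify
        show "\<exists>c. \<forall>f. value_at (E j) \<one> f = (\<Sum>i\<in>UNIV. c i * E i f \<one>)" for j
          by (rule exI[of _ "\<lambda>i. if i = j then 1 else 0"])
             (simp add: value_at_apply if_distrib[of "\<lambda>x. x * _"] cong: if_cong)
      qed
      show "tangent.subspace {v. \<exists>c. \<forall>f. v f = (\<Sum>i\<in>UNIV. c i * E i f \<one>)}"
        unfolding tangent.subspace_def
      proof (intro conjI ballI allI; clarify?)
        show "\<exists>c. \<forall>f. 0 f = (\<Sum>i\<in>UNIV. c i * E i f \<one>)" by (rule exI[of _ "\<lambda>_. 0"]) simp
        fix x y c d assume "\<forall>f. x f = (\<Sum>i\<in>UNIV. c i * E i f \<one>)" "\<forall>f. y f = (\<Sum>i\<in>UNIV. d i * E i f \<one>)"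
        then show "\<exists>c. \<forall>f. (x + y) f = (\<Sum>i\<in>UNIV. c i * E i f \<one>)"
          by (intro exI[of _ "\<lambda>i. c i + d i"]) (simp add: distrib_right sum.distrib)
      next
        fix r x c assume "\<forall>f. x f = (\<Sum>i\<in>UNIV. c i * E i f \<one>)"
        then show "\<exists>c. \<forall>f. tscale r x f = (\<Sum>i\<in>UNIV. c i * E i f \<one>)"
          by (intro exI[of _ "\<lambda>i. r * c i"]) (simp add: tscale_def sum_distrib_left mult.assoc)
      qed
    qed
    then show ?thesis using that span by blast
  qed
  show ?thesis
  proof unfold_locales
    show "riemannian_metric A g" using g by (simp add: left_invariant_metric_def)
    show "E i \<in> vector_fields A" for i by (rule EV)
    show "E i \<in> left_invariant_fields G A" for i by (rule E)
    show "CARD('i) \<le> DIM('m)" by (rule card)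
    show "g p (value_at (E i) p) (value_at (E j) p) = (if i = j then 1 else 0)" for p i j
    proof -
      have "g (p \<otimes> \<one>) (pushforward A (\<lambda>q. p \<otimes> q) (value_at (E i) \<one>))
          (pushforward A (\<lambda>q. p \<otimes> q) (value_at (E j) \<one>)) = g \<one> (value_at (E i) \<one>) (value_at (E j) \<one>)"
        using g field_tangent[OF EV] unfolding left_invariant_metric_def by blast
      then show ?thesis by (simp add: shift[symmetric] ortho)
    qed
    show "\<exists>c. \<forall>f. v f = (\<Sum>i\<in>UNIV. c i * E i f p)" if v: "v \<in> tangent_space A p" for p v
    proof -
      have "pushforward A (\<lambda>q. inv p \<otimes> q) v \<in> tangent_space A (inv p \<otimes> p)"
        by (rule tangent_pushforward[OF smooth_left_translation v])
      then obtain c where c: "\<And>f. pushforward A (\<lambda>q. inv p \<otimes> q) v f = (\<Sum>i\<in>UNIV. c i * E i f \<one>)"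
        using one by auto
      have "v f = (\<Sum>i\<in>UNIV. c i * E i f p)" for f
      proof (cases "f \<in> smooth_functions A")
        case True
        \<comment> \<open>Moving \<open>v\<close> to the identity and testing on the translated
          function restores \<open>v f\<close>.\<close>
        have "v f = pushforward A (\<lambda>q. inv p \<otimes> q) v (\<lambda>q. f (p \<otimes> q))"
          using smooth_left_translation[OF True] by (simp add: pushforward_def comp_def)
        also have "\<dots> = (\<Sum>i\<in>UNIV. c i * E i f p)"
          by (simp only: c left_invariant_at_one[OF E True, symmetric])
        finally show ?thesis .
      next
        case False
        then show ?thesis by (simp add: tangent_nonsmooth[OF v] field_nonsmooth[OF EV])
      qed
      then show ?thesis by blast
    qed
  qed
qed

text \<open>A constant combination of left-invariant fields is determined by its value at
  \<open>\<one>\<close>. \<open>has_triple\<close> fixes the brackets only there, whereas the Jacobi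
  computation uses them as identities of fields.\<close>

lemma left_invariant_eqI:
  assumes X: "X \<in> left_invariant_fields G A" and Y: "\<And>i. Y i \<in> left_invariant_fields G A"
    and val: "\<And>f. X f \<one> = (\<Sum>i\<in>I. r i * Y i f \<one>)"
  shows "X f p = (\<Sum>i\<in>I. r i * Y i f p)"
proof (cases "f \<in> smooth_functions A")
  case True
  show ?thesis
    by (simp only: left_invariant_at_one[OF X True] left_invariant_at_one[OF Y True] val)
next
  case False
  then show ?thesis
    by (simp add: field_nonsmooth[OF left_invariant_vector_field[OF X]]
        field_nonsmooth[OF left_invariant_vector_field[OF Y]])
qed

lemma triple_frame_exists:
  assumes g: "left_invariant_metric G A g" and T: "has_triple G A g a b c" and dim: "3 \<le> DIM('m)"
  obtains E where "triple_frame G A g E a b c"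
proof -
  obtain E1 E2 E3 where E123: "E1 \<in> left_invariant_fields G A" "E2 \<in> left_invariant_fields G A"
      "E3 \<in> left_invariant_fields G A"
    and o: "g \<one> (value_at E1 \<one>) (value_at E1 \<one>) = 1" "g \<one> (value_at E2 \<one>) (value_at E2 \<one>) = 1"
      "g \<one> (value_at E3 \<one>) (value_at E3 \<one>) = 1" "g \<one> (value_at E1 \<one>) (value_at E2 \<one>) = 0"
      "g \<one> (value_at E1 \<one>) (value_at E3 \<one>) = 0" "g \<one> (value_at E2 \<one>) (value_at E3 \<one>) = 0"
    and span: "tangent_span {value_at E1 \<one>, value_at E2 \<one>, value_at E3 \<one>} = tangent_space A \<one>"
    and br: "value_at (bracket E1 E2) \<one> = tscale a (value_at E2 \<one>) + tscale b (value_at E3 \<one>)"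
      "value_at (bracket E1 E3) \<one> = tscale c (value_at E2 \<one>) + tscale a (value_at E3 \<one>)"
      "value_at (bracket E2 E3) \<one> = 0"
    using T unfolding has_triple_def Let_def by blast
  \<comment> \<open>In the index type \<open>3\<close> the numeral 3 is 0, which falls under the
    last case.\<close>
  define E :: "3 \<Rightarrow> 'g vfield" where "E i = (if i = 1 then E1 else if i = 2 then E2 else E3)" for i
  have E[simp]: "E 1 = E1" "E 2 = E2" "E 3 = E3" by (simp_all add: E_def)
  have L: "E i \<in> left_invariant_fields G A" for i using E123 by (simp add: E_def)
  have sym: "g \<one> (value_at X \<one>) (value_at Y \<one>) = g \<one> (value_at Y \<one>) (value_at X \<one>)"
    if "X \<in> left_invariant_fields G A" "Y \<in> left_invariant_fields G A" for X Y
    using g field_tangent[OF left_invariant_vector_field] that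
    by (simp add: left_invariant_metric_def riemannian_metric_def)
  have ortho: "g \<one> (value_at (E i) \<one>) (value_at (E j) \<one>) = (if i = j then 1 else 0)" for i j
    using exhaust_3[of i] exhaust_3[of j] o sym[OF E123(2,1)] sym[OF E123(3,1)] sym[OF E123(3,2)]
    by auto
  have "range (\<lambda>i. value_at (E i) \<one>) = {value_at E1 \<one>, value_at E2 \<one>, value_at E3 \<one>}"
    by (simp add: UNIV_3)
  then have "left_invariant_frame G A g E"
    using left_invariant_frameI[OF g L ortho] span dim by simp
  moreover have "triple_frame_axioms E a b c"
  proof
    fix f p
    have e: "bracket (E i) (E j) f p = (\<Sum>k\<in>UNIV. r k * E k f p)"
      if "\<And>f. bracket (E i) (E j) f \<one> = (\<Sum>k\<in>UNIV. r k * E k f \<one>)" for i j r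
      by (rule left_invariant_eqI[OF left_invariant_bracket[OF L L] L that])
    show "bracket (E 1) (E 2) f p = a * E 2 f p + b * E 3 f p"
      using e[of 1 2 "\<lambda>k. if k = 1 then 0 else if k = 2 then a else b"] fun_cong[OF br(1)]
      by (simp add: sum_3 value_at_apply tscale_def)
    show "bracket (E 1) (E 3) f p = c * E 2 f p + a * E 3 f p"
      using e[of 1 3 "\<lambda>k. if k = 1 then 0 else if k = 2 then c else a"] fun_cong[OF br(2)]
      by (simp add: sum_3 value_at_apply tscale_def)
    show "bracket (E 2) (E 3) f p = 0"
      using e[of 2 3 "\<lambda>k. 0"] fun_cong[OF br(3)] by (simp add: value_at_apply)
  qed
  ultimately show thesis using that by (simp add: triple_frame_def)
qed

end

theorem proposition8p1:
  fixes a b c :: real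
    and G :: "'g::{t2_space, second_countable_topology} monoid"
    and A :: "('g, real ^ 3) chart set"
    and g :: "'g metric_tensor"
    and D :: "'g vfield \<Rightarrow> 'g vfield \<Rightarrow> 'g vfield"
  assumes "a \<ge> 0" and "b \<ge> \<bar>c\<bar>"
    and "lie_group G A"
    and "simply_connected (UNIV :: 'g set)"
    and "left_invariant_metric G A g"
    and "has_triple G A g a b c"
    and "levi_civita A g D"
    and "generic a b c"
  shows "index_space G A g D = subindex_space G A D \<and> index G A g D = subindex G A D"
proof -
  interpret Lie_group G A by unfold_locales (rule assms)
  obtain E where "triple_frame G A g E a b c"
    using triple_frame_exists[OF assms(5,6)] by auto
  then interpret triple_frame G A g E a b c .
  have "index_space G A g D = subindex_space G A D"
    by (rule index_space_eq_subindex_space[OF assms(7) killing_commutes_frame[OF assms(8)]])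
  then show ?thesis by (simp add: index_def subindex_def)
qed

end
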